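(* Let $G$ be a graph with a distinguished vertex $o$, and let $\rho$ be a metric on the vertices of $G$ satisfying conditions (C), (VG) and (wLB) below. Then there exists a constant $c_1>0$ such that for every $\varepsilon>0$, $$\Pr\big[A_{b_o(n)}(o)\not\subset B_o((1+\varepsilon)n)\ \text{ for infinitely many } n\big]\le \Pr\big[|A_{b_o(n)}(o\mapsto n)|<b_o(n)(1-c_1\varepsilon^d)\ \text{ for infinitely many } n\big],$$ where $d$ is the exponent in (VG).
   Context: $G$ is a connected locally finite graph with graph distance $d_G$; "random walk" means simple random walk on $G$. For a metric $\rho$, $B_x(r)=\{y:\rho(x,y)<r\}$ and $b_x(r)=|B_x(r)|$. IDLA: for finite $S\subset G$, $x\in G$, $T\subset G$, let $\xi$ be a random walk started at $x$, $t_S$ the first time $\xi\notin S$, $t_T$ the first time $\xi\notin T$. Set $A(S;x)=S\cup\{\xi(t_S)\}$, $A(S;x\mapsto T)=S\cup\{\xi(t_S\wedge(t_T-1))\}$. For $x_1,\dots,x_k$ define inductively (with independent walks) $S_0=S$, $S_j=A(S_{j-1};x_j\mapsto T)$, and $A(S;x_1,\dots,x_k\mapsto T)=S_k$; similarly $A(S;x_1,\dots,x_k)$ without pausing. Put $A_m(x)=A(\emptyset;x,\dots,x)$ and $A_m(x\mapsto r)=A(\emptyset;x,\dots,x\mapsto B_x(r))$ ($m$ copies of $x$). Conditions: (C) there is $c>0$ with $\rho(x,y)\le c\,d_G(x,y)$ for all $x,y$. (VG) there are $c,d>0$ such that for every $n>0$, $\frac1c r^d\le |B_x(r)|\le c r^d$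 for all $x\in B_o(n)$ and $n^{1/d^3}\le r\le n$. (wLB) there is $\alpha>0$ such that for every $n>0$, $\Pr[B_x(r)\subset A_{b_x(r/\alpha)}(x\mapsto r)]\ge\alpha$ for all $x\in B_o(n+r)$ and $n^{1/d^3}\le r\le n$. *)

theory Defs
  imports "HOL-Probability.Probability"
begin

definition locally_finite_connected_graph :: "('a \<Rightarrow> 'a \<Rightarrow> bool) \<Rightarrow> bool" where
  "locally_finite_connected_graph E \<longleftrightarrow>
     (\<forall>x y. E x y \<longrightarrow> E y x) \<and> (\<forall>x. \<not> E x x) \<and>
     (\<forall>x. finite {y. E x y}) \<and> (\<forall>x y. E\<^sup>*\<^sup>* x y)"

definition graph_dist :: "('a \<Rightarrow> 'a \<Rightarrow> bool) \<Rightarrow> 'a \<Rightarrow> 'a \<Rightarrow> nat" where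
  "graph_dist E x y = (LEAST n. (E ^^ n) x y)"

definition degree :: "('a \<Rightarrow> 'a \<Rightarrow> bool) \<Rightarrow> 'a \<Rightarrow> nat" where
  "degree E x = card {y. E x y}"

definition srw_P :: "('a \<Rightarrow> 'a \<Rightarrow> bool) \<Rightarrow> 'a \<Rightarrow> 'a \<Rightarrow> real" where
  "srw_P E x y = (if E x y then 1 / real (degree E x) else 0)"

text \<open>W x i \<omega> is the i-th walk (a path nat => 'a) started at x. The family (W x i)_i
  consists of independent simple random walks started at x: all finite-dimensional
  (cylinder) probabilities are the product of the transition probabilities.\<close>
definition iid_srw_family ::
    "('a \<Rightarrow> 'a \<Rightarrow> bool) \<Rightarrow> 'w measure \<Rightarrow> ('a \<Rightarrow> nat \<Rightarrow> 'w \<Rightarrow> nat \<Rightarrow> 'a) \<Rightarrow> bool" where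
  "iid_srw_family E M W \<longleftrightarrow>
     prob_space M \<and>
     (\<forall>x i t. (\<lambda>\<omega>. W x i \<omega> t) \<in> measurable M (count_space UNIV)) \<and>
     (\<forall>x (m::nat) (k::nat) (p :: nat \<Rightarrow> nat \<Rightarrow> 'a).
        measure M {\<omega> \<in> space M. \<forall>i<m. \<forall>t\<le>k. W x i \<omega> t = p i t}
        = (\<Prod>i<m. if p i 0 = x then (\<Prod>t<k. srw_P E (p i t) (p i (Suc t))) else 0))"

definition is_metric :: "('a \<Rightarrow> 'a \<Rightarrow> real) \<Rightarrow> bool" where
  "is_metric \<rho> \<longleftrightarrow> (\<forall>x y. 0 \<le> \<rho> x y) \<and> (\<forall>x y. \<rho> x y = 0 \<longleftrightarrow> x = y) \<and>
     (\<forall>x y. \<rho> x y = \<rho> y x) \<and> (\<forall>x y z. \<rho> x z \<le> \<rho> x y + \<rho> y z)"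

definition ball_rho :: "('a \<Rightarrow> 'a \<Rightarrow> real) \<Rightarrow> 'a \<Rightarrow> real \<Rightarrow> 'a set" where
  "ball_rho \<rho> x r = {y. \<rho> x y < r}"

definition bsize :: "('a \<Rightarrow> 'a \<Rightarrow> real) \<Rightarrow> 'a \<Rightarrow> real \<Rightarrow> nat" where
  "bsize \<rho> x r = card (ball_rho \<rho> x r)"

definition exit_time :: "'a set \<Rightarrow> (nat \<Rightarrow> 'a) \<Rightarrow> nat" where
  "exit_time S p = (LEAST t. p t \<notin> S)"

definition idla_step :: "'a set \<Rightarrow> (nat \<Rightarrow> 'a) \<Rightarrow> 'a set" where
  "idla_step S p = insert (p (exit_time S p)) S"

definition idla_step_paused :: "'a set \<Rightarrow> 'a set \<Rightarrow> (nat \<Rightarrow> 'a) \<Rightarrow> 'a set" where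
  "idla_step_paused T S p = insert (p (min (exit_time S p) (exit_time T p - 1))) S"

fun idla :: "(nat \<Rightarrow> nat \<Rightarrow> 'a) \<Rightarrow> nat \<Rightarrow> 'a set" where
  "idla ps 0 = {}"
| "idla ps (Suc k) = idla_step (idla ps k) (ps k)"

fun idla_paused :: "'a set \<Rightarrow> (nat \<Rightarrow> nat \<Rightarrow> 'a) \<Rightarrow> nat \<Rightarrow> 'a set" where
  "idla_paused T ps 0 = {}"
| "idla_paused T ps (Suc k) = idla_step_paused T (idla_paused T ps k) (ps k)"

definition cond_C :: "('a \<Rightarrow> 'a \<Rightarrow> bool) \<Rightarrow> ('a \<Rightarrow> 'a \<Rightarrow> real) \<Rightarrow> bool" where
  "cond_C E \<rho> \<longleftrightarrow> (\<exists>c>0. \<forall>x y. \<rho> x y \<le> c * real (graph_dist E x y))"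

definition cond_VG :: "('a \<Rightarrow> 'a \<Rightarrow> real) \<Rightarrow> 'a \<Rightarrow> real \<Rightarrow> real \<Rightarrow> bool" where
  "cond_VG \<rho> v0 c d \<longleftrightarrow> 0 < c \<and> 0 < d \<and>
     (\<forall>n>0. \<forall>x \<in> ball_rho \<rho> v0 n. \<forall>r. n powr (1 / d ^ 3) \<le> r \<and> r \<le> n \<longrightarrow>
        (1 / c) * r powr d \<le> real (bsize \<rho> x r) \<and> real (bsize \<rho> x r) \<le> c * r powr d)"

definition cond_wLB ::
    "('a \<Rightarrow> 'a \<Rightarrow> real) \<Rightarrow> 'a \<Rightarrow> real \<Rightarrow> 'w measure \<Rightarrow> ('a \<Rightarrow> nat \<Rightarrow> 'w \<Rightarrow> nat \<Rightarrow> 'a) \<Rightarrow> bool" where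
  "cond_wLB \<rho> v0 d M W \<longleftrightarrow> (\<exists>\<alpha>>0. \<forall>n>0. \<forall>r. n powr (1 / d ^ 3) \<le> r \<and> r \<le> n \<longrightarrow>
     (\<forall>x \<in> ball_rho \<rho> v0 (n + r).
        \<alpha> \<le> measure M {\<omega> \<in> space M.
               ball_rho \<rho> x r \<subseteq> idla_paused (ball_rho \<rho> x r) (\<lambda>i. W x i \<omega>) (bsize \<rho> x (r / \<alpha>))}))"

end

(* No abelian property is needed: driven by the same walks, the paused cluster is contained in the
   unpaused one, so if the paused cluster nearly fills B(n), few particles of the unpaused cluster
   settle outside B(n). By (wLB) and (VG), a walk arriving at a point x has a chance of at least
   some constant delta to settle in B_x(r) as long as half of this ball is empty. Hence, if at most
   k particles settle outside B(R), then with r of order k^(1/d) each of them is at least delta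
   times as likely to settle inside B(R + 3r) as beyond it, and an exponential supermartingale shows
   that at most beta * k settle beyond it, up to a probability exponentially small in k. Iterating,
   the widths of the annuli form a geometric series with sum of order epsilon * n. Once r drops
   below n^(1/d^3), of the order of n^(1/d^2) = o(n) particles are left, and by (C) each of them
   extends the cluster by a bounded distance. The error probabilities are summable, so Borel-Cantelli applies. *)
theory Submission
  imports Defs "HOL-Real_Asymp.Real_Asymp"
begin

section \<open>Hitting probabilities of the walk\<close>

text \<open>Condition (wLB) speaks of walks started at \<open>x\<close>, the process of walks
  started at \<open>v0\<close>, and \<open>iid_srw_family\<close> does not relate walks from
  different vertices. The bridge is the deterministic function \<open>hit_prob\<close>: covering a
  ball from \<open>x\<close> bounds it below at \<open>x\<close>, and averaging over neighbours
  carries the bound to \<open>v0\<close> (\<open>hit_prob_compare\<close>). Origin of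
  \<open>\<delta>\<close>: if b_x(r/\<alpha>) particles from \<open>x\<close> cover a ball
  \<open>T\<close>, each point of a set \<open>F\<close> inside \<open>T\<close> is filled by a
  different explorer that entered \<open>F\<close> before leaving \<open>T\<close>. Taking
  expectations, card F times \<alpha> is at most b_x(r/\<alpha>) times the chance of one walk to
  enter \<open>F\<close>. By (VG) this chance is at least a constant as soon as \<open>F\<close> has
  r^d/(2c) points, half of the smallest volume that (VG) allows; hence the relation k = r^d/(2c)
  between particles and radii. Since (VG) and (wLB) hold only at radii tied to their parameter, one
  parameter \<open>N\<close> of order n is fixed for all annuli. The inequality of the theorem comes
  from an inclusion of the two events that holds almost surely.\<close>

locale srw_graph =
  fixes E :: "'a \<Rightarrow> 'a \<Rightarrow> bool"
  assumes graph: "locally_finite_connected_graph E"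
    and degree_pos: "degree E x > 0"
begin

lemma finite_neighbours: "finite {y. E x y}"
  using graph by (auto simp: locally_finite_connected_graph_def)

lemma countable_vertices: "countable (UNIV :: 'a set)"
proof -
  fix v :: 'a
  have fin: "finite {y. (E ^^ n) v y}" for n
  proof (induction n)
    case (Suc n)
    have "{y. (E ^^ Suc n) v y} = (\<Union>z\<in>{z. (E ^^ n) v z}. {y. E z y})"
      by auto
    then show ?case using Suc finite_neighbours by simp
  qed simp
  have "UNIV = (\<Union>n. {y. (E ^^ n) v y})"
  proof (rule set_eqI)
    fix y
    have "E\<^sup>*\<^sup>* v y"
      using graph by (simp add: locally_finite_connected_graph_def)
    then obtain n where "(E ^^ n) v y"
      using rtranclp_imp_relpowp by metis
    then show "y \<in> UNIV \<longleftrightarrow> y \<in> (\<Union>n. {y. (E ^^ n) v y})"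
      by blast
  qed
  then show ?thesis
    using countable_UN[of UNIV "\<lambda>n. {y. (E ^^ n) v y}"] countable_finite[OF fin] by simp
qed

lemma srw_P_nonneg: "0 \<le> srw_P E x y"
  by (simp add: srw_P_def)

lemma srw_P_sum: "(\<Sum>y | E x y. srw_P E x y) = 1"
  using degree_pos[of x] by (simp add: srw_P_def degree_def)

text \<open>Finite-horizon probability of entering \<open>F\<close> while staying in
  \<open>A\<close> before. It is defined by first-step analysis rather than through
  \<open>W\<close>, so that its values at different vertices can be compared. \<open>F\<close> is
  tested before \<open>A\<close>: the arrival point may lie inside or outside
  \<open>A\<close>.\<close>

primrec hit :: "nat \<Rightarrow> 'a set \<Rightarrow> 'a set \<Rightarrow> 'a \<Rightarrow> real" where
  "hit 0 A F x = (if x \<in> F then 1 else 0)"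
| "hit (Suc k) A F x = (if x \<in> F then 1 else if x \<in> A
     then \<Sum>y | E x y. srw_P E x y * hit k A F y else 0)"

definition hit_prob :: "'a set \<Rightarrow> 'a set \<Rightarrow> 'a \<Rightarrow> real" where
  "hit_prob A F x = (SUP k. hit k A F x)"

lemma hit_bounds: "0 \<le> hit k A F x \<and> hit k A F x \<le> 1"
proof (induction k arbitrary: x)
  case (Suc k)
  have "(\<Sum>y | E x y. srw_P E x y * hit k A F y) \<le> (\<Sum>y | E x y. srw_P E x y * 1)"
    by (intro sum_mono mult_left_mono) (auto simp: Suc srw_P_nonneg)
  moreover have "0 \<le> (\<Sum>y | E x y. srw_P E x y * hit k A F y)"
    by (intro sum_nonneg mult_nonneg_nonneg) (auto simp: Suc srw_P_nonneg)
  ultimately show ?case by (simp add: srw_P_sum)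
qed simp

lemma hit_Suc_mono: "hit k A F x \<le> hit (Suc k) A F x"
proof (induction k arbitrary: x)
  case 0
  show ?case by (auto intro!: sum_nonneg simp: srw_P_nonneg)
next
  case (Suc k)
  have "(\<Sum>y | E x y. srw_P E x y * hit k A F y) \<le> (\<Sum>y | E x y. srw_P E x y * hit (Suc k) A F y)"
    by (intro sum_mono mult_left_mono Suc srw_P_nonneg)
  then show ?case by (simp del: hit.simps(2) add: hit.simps(2)[of k] hit.simps(2)[of "Suc k"])
qed

lemma hit_tendsto: "(\<lambda>k. hit k A F x) \<longlonglongrightarrow> hit_prob A F x"
  unfolding hit_prob_def
  by (rule LIMSEQ_incseq_SUP)
    (auto simp: incseq_Suc_iff hit_Suc_mono hit_bounds intro!: bdd_aboveI[of _ 1] simp del: hit.simps)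

lemma hit_le_hit_prob: "hit k A F x \<le> hit_prob A F x"
  unfolding hit_prob_def
  by (rule cSUP_upper) (auto intro!: bdd_aboveI[of _ 1] simp: hit_bounds)

lemma hit_prob_nonneg: "0 \<le> hit_prob A F x"
  using hit_le_hit_prob[of 0 A F x] hit_bounds[of 0 A F x] by linarith

lemma hit_mono:
  assumes "A \<subseteq> A'" "F \<subseteq> F'"
  shows "hit k A F x \<le> hit k A' F' x"
proof (induction k arbitrary: x)
  case (Suc k)
  have le: "(\<Sum>y | E x y. srw_P E x y * hit k A F y) \<le> (\<Sum>y | E x y. srw_P E x y * hit k A' F' y)"
    by (intro sum_mono mult_left_mono Suc srw_P_nonneg)
  have "(\<Sum>y | E x y. srw_P E x y * hit k A F y) \<le> 1" if "x \<in> A" "x \<notin> F"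
    using hit_bounds[of "Suc k" A F x] that by simp
  moreover have "0 \<le> (\<Sum>y | E x y. srw_P E x y * hit k A' F' y)"
    by (intro sum_nonneg mult_nonneg_nonneg) (auto simp: hit_bounds srw_P_nonneg)
  ultimately show ?case using le assms by auto
qed (use assms in auto)

lemma hit_prob_mono:
  assumes "A \<subseteq> A'" "F \<subseteq> F'"
  shows "hit_prob A F x \<le> hit_prob A' F' x"
  by (rule LIMSEQ_le[OF hit_tendsto hit_tendsto]) (use hit_mono[OF assms] in auto)

lemma hit_prob_step:
  assumes "x \<in> A" "x \<notin> F"
  shows "hit_prob A F x = (\<Sum>y | E x y. srw_P E x y * hit_prob A F y)"
proof (rule LIMSEQ_unique)
  show "(\<lambda>k. hit (Suc k) A F x) \<longlonglongrightarrow> hit_prob A F x"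
    using hit_tendsto by (rule LIMSEQ_Suc)
  show "(\<lambda>k. hit (Suc k) A F x) \<longlonglongrightarrow> (\<Sum>y | E x y. srw_P E x y * hit_prob A F y)"
    using assms by (auto intro!: tendsto_sum tendsto_mult hit_tendsto)
qed

text \<open>The strong Markov property at the exit from \<open>D\<close>: to settle in \<open>F\<close> the walk
  has to pass a point where it has a chance \<open>\<delta>\<close> of settling in \<open>F'\<close>.\<close>

lemma hit_prob_compare:
  assumes "x \<in> D" "D \<inter> F = {}" "S \<inter> F' = {}" "0 < \<delta>"
    and bdry: "\<And>y z. y \<in> D \<Longrightarrow> E y z \<Longrightarrow> z \<notin> D \<Longrightarrow> \<delta> \<le> hit_prob S F' z"
  shows "\<delta> * hit_prob S F x \<le> hit_prob S F' x"
proof -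
  \<comment> \<open>Only the left side is truncated: a step of the walk shortens its horizon by one,
    while on the right \<open>hit_prob_step\<close> reproduces \<open>hit_prob\<close> itself. For a
    step that leaves \<open>D\<close>, \<open>bdry\<close> is combined with the trivial bound 1 on
    \<open>hit\<close>.\<close>
  have "\<delta> * hit k S F x \<le> hit_prob S F' x" if "x \<in> D" for k x
    using that
  proof (induction k arbitrary: x)
    case 0
    then show ?case using assms by (auto simp: hit_prob_nonneg)
  next
    case (Suc k)
    have xF: "x \<notin> F" using Suc.prems assms by auto
    show ?case
    proof (cases "x \<in> S")
      case True
      have step: "\<delta> * hit k S F y \<le> hit_prob S F' y" if "E x y" for y
      proof (cases "y \<in> D")
        case False
        have "\<delta> * hit k S F y \<le> \<delta> * 1"
          using hit_bounds[of k S F y] \<open>0 < \<delta>\<close> by (intro mult_left_mono) auto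
        then show ?thesis using bdry[OF Suc.prems that False] by simp
      qed (use Suc.IH in auto)
      have "\<delta> * hit (Suc k) S F x = (\<Sum>y | E x y. srw_P E x y * (\<delta> * hit k S F y))"
        using True xF by (simp add: sum_distrib_left mult_ac)
      also have "\<dots> \<le> (\<Sum>y | E x y. srw_P E x y * hit_prob S F' y)"
        by (intro sum_mono mult_left_mono srw_P_nonneg) (use step in auto)
      also have "\<dots> = hit_prob S F' x"
        using True assms(3) by (subst hit_prob_step) auto
      finally show ?thesis .
    qed (use xF in \<open>simp add: hit_prob_nonneg\<close>)
  qed
  then have "\<And>k. \<delta> * hit k S F x \<le> hit_prob S F' x"
    using assms(1) by blast
  then show ?thesis
    by (intro LIMSEQ_le_const2[OF tendsto_mult[OF tendsto_const hit_tendsto]]) auto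
qed

end

text \<open>With \<open>F\<close> disjoint from \<open>A\<close> this says that the walk leaves
  \<open>A\<close> and is in \<open>F\<close> when it does. A path that stays in \<open>A\<close>
  forever makes it false, whereas \<open>exit_time\<close> is then an unspecified number.\<close>

definition hits :: "'a set \<Rightarrow> 'a set \<Rightarrow> (nat \<Rightarrow> 'a) \<Rightarrow> bool" where
  "hits A F p \<longleftrightarrow> (\<exists>t. p t \<in> F \<and> (\<forall>s<t. p s \<in> A))"

section \<open>Independence and the law of a single walk\<close>

text \<open>The identity is summed over the countably many atoms of \<open>X\<close>. The factor is
  a number \<open>q\<close> rather than \<open>prob C\<close>, so that it can be identified
  afterwards by taking all values of \<open>X\<close> together.\<close>

lemma (in prob_space) prob_Int_discrete:
  fixes X :: "'a \<Rightarrow> 'b"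
  assumes X: "X \<in> measurable M (count_space UNIV)" and cnt: "countable (UNIV :: 'b set)"
    and C: "C \<in> events" and q: "0 \<le> q"
    and eq: "\<And>u. prob ({\<omega> \<in> space M. X \<omega> = u} \<inter> C) = prob {\<omega> \<in> space M. X \<omega> = u} * q"
  shows "prob ({\<omega> \<in> space M. X \<omega> \<in> A} \<inter> C) = prob {\<omega> \<in> space M. X \<omega> \<in> A} * q"
proof -
  have X'[measurable]: "{\<omega> \<in> space M. X \<omega> = u} \<in> events" for u
    using measurable_sets[OF X, of "{u}"] by (simp add: vimage_def Int_def conj_commute)
  have cA: "countable A" by (rule countable_subset[OF subset_UNIV cnt])
  have 1: "{\<omega> \<in> space M. X \<omega> \<in> A} = (\<Union>u\<in>A. {\<omega> \<in> space M. X \<omega> = u})" by auto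
  have "emeasure M ({\<omega> \<in> space M. X \<omega> \<in> A} \<inter> C) = emeasure M (\<Union>u\<in>A. {\<omega> \<in> space M. X \<omega> = u} \<inter> C)"
    by (rule arg_cong[where f="emeasure M"]) auto
  also have "\<dots> = (\<integral>\<^sup>+u. emeasure M ({\<omega> \<in> space M. X \<omega> = u} \<inter> C) \<partial>count_space A)"
    using C by (intro emeasure_UN_countable cA) (auto simp: disjoint_family_on_def)
  also have "\<dots> = (\<integral>\<^sup>+u. emeasure M {\<omega> \<in> space M. X \<omega> = u} * ennreal q \<partial>count_space A)"
    using q by (intro nn_integral_cong) (simp add: emeasure_eq_measure eq ennreal_mult)
  also have "\<dots> = (\<integral>\<^sup>+u. emeasure M {\<omega> \<in> space M. X \<omega> = u} \<partial>count_space A) * ennreal q"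
    by (intro nn_integral_multc) simp
  also have "(\<integral>\<^sup>+u. emeasure M {\<omega> \<in> space M. X \<omega> = u} \<partial>count_space A) = emeasure M {\<omega> \<in> space M. X \<omega> \<in> A}"
    unfolding 1 by (intro emeasure_UN_countable[symmetric] cA) (auto simp: disjoint_family_on_def)
  finally show ?thesis
    using q by (simp add: emeasure_eq_measure flip: ennreal_mult)
qed

locale srw_walks = srw_graph E
  for E :: "'a \<Rightarrow> 'a \<Rightarrow> bool" +
  fixes M :: "'w measure" and W :: "'a \<Rightarrow> nat \<Rightarrow> 'w \<Rightarrow> nat \<Rightarrow> 'a"
  assumes iid: "iid_srw_family E M W"
begin

sublocale prob_space M
  using iid by (simp add: iid_srw_family_def)

lemma W_measurable[measurable]: "(\<lambda>\<omega>. W x i \<omega> t) \<in> measurable M (count_space UNIV)"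
  using iid by (simp add: iid_srw_family_def)

definition path_weight :: "'a \<Rightarrow> nat \<Rightarrow> (nat \<Rightarrow> 'a) \<Rightarrow> real" where
  "path_weight x k p = (if p 0 = x then \<Prod>t<k. srw_P E (p t) (p (Suc t)) else 0)"

definition initial_path :: "'a \<Rightarrow> nat \<Rightarrow> nat \<Rightarrow> 'w \<Rightarrow> 'a list" where
  "initial_path x i k \<omega> = map (W x i \<omega>) [0..<Suc k]"

definition past :: "'a \<Rightarrow> nat \<Rightarrow> nat \<Rightarrow> 'w \<Rightarrow> 'a list list" where
  "past x m k \<omega> = map (\<lambda>i. initial_path x i k \<omega>) [0..<m]"

lemma path_weight_nonneg: "0 \<le> path_weight x k p"
  by (simp add: path_weight_def prod_nonneg srw_P_nonneg)

lemma prob_cylinders: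
  "prob {\<omega> \<in> space M. \<forall>i<m. \<forall>t\<le>k. W x i \<omega> t = p i t} = (\<Prod>i<m. path_weight x k (p i))"
  using iid by (simp add: iid_srw_family_def path_weight_def)

lemma countable_paths: "countable (UNIV :: 'a list set)"
  using countable_lists[OF countable_vertices] by (simp add: lists_UNIV)

lemma countable_pasts: "countable (UNIV :: 'a list list set)"
  using countable_lists[OF countable_paths] by (simp add: lists_UNIV)

lemma path_eq_iff: "initial_path x i k \<omega> = v \<longleftrightarrow> length v = Suc k \<and> (\<forall>t\<le>k. W x i \<omega> t = v ! t)"
  by (auto simp: initial_path_def list_eq_iff_nth_eq less_Suc_eq_le nth_append simp del: upt_Suc)

lemma past_eq_iff:
  "past x m k \<omega> = u \<longleftrightarrow> length u = m \<and> (\<forall>i<m. length (u ! i) = Suc k) \<and>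
     (\<forall>i<m. \<forall>t\<le>k. W x i \<omega> t = u ! i ! t)"
proof -
  have "past x m k \<omega> = u \<longleftrightarrow> length u = m \<and> (\<forall>i<m. initial_path x i k \<omega> = u ! i)"
    unfolding past_def by (subst list_eq_iff_nth_eq) auto
  then show ?thesis by (auto simp: path_eq_iff)
qed

lemma path_measurable[measurable]: "initial_path x i k \<in> measurable M (count_space UNIV)"
proof -
  have "{\<omega> \<in> space M. initial_path x i k \<omega> = v} \<in> events" for v
    unfolding path_eq_iff by measurable
  then show ?thesis
    by (subst measurable_count_space_eq_countable[OF countable_paths])
      (simp add: vimage_def Int_def conj_commute)
qed

lemma past_measurable[measurable]: "past x m k \<in> measurable M (count_space UNIV)"
proof -
  have "{\<omega> \<in> space M. past x m k \<omega> = v} \<in> events" for v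
    unfolding past_eq_iff by measurable
  then show ?thesis
    by (subst measurable_count_space_eq_countable[OF countable_pasts])
      (simp add: vimage_def Int_def conj_commute)
qed

lemma path_in_sets[measurable]: "{\<omega> \<in> space M. initial_path x m k \<omega> \<in> A} \<in> events"
  using measurable_sets[OF path_measurable, of A x m k] by (simp add: vimage_def Int_def conj_commute)

lemma past_in_sets[measurable]: "{\<omega> \<in> space M. past x m k \<omega> \<in> A} \<in> events"
  using measurable_sets[OF past_measurable, of A x m k] by (simp add: vimage_def Int_def conj_commute)

text \<open>The cylinder formula for the walks 0 to \<open>i\<close> with a common horizon is a
  product whose last factor belongs to walk \<open>i\<close>. Initial segments are encoded as lists
  because these form a countable set.\<close>

lemma prob_path_eq:
  "prob {\<omega> \<in> space M. initial_path x i k \<omega> = v} = (if length v = Suc k then path_weight x k ((!) v) else 0)"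
  (is "?L = ?q")
  and prob_past_path_eq:
  "prob {\<omega> \<in> space M. past x i k \<omega> = u \<and> initial_path x i k \<omega> = v}
    = prob {\<omega> \<in> space M. past x i k \<omega> = u} * prob {\<omega> \<in> space M. initial_path x i k \<omega> = v}"
proof -
  have both: "prob ({\<omega> \<in> space M. past x i k \<omega> = u} \<inter> {\<omega> \<in> space M. initial_path x i k \<omega> = v})
      = prob {\<omega> \<in> space M. past x i k \<omega> = u} * ?q" for u
  proof (cases "length v = Suc k \<and> length u = i \<and> (\<forall>j<i. length (u ! j) = Suc k)")
    case True
    have "{\<omega> \<in> space M. past x i k \<omega> = u} \<inter> {\<omega> \<in> space M. initial_path x i k \<omega> = v}
        = {\<omega> \<in> space M. \<forall>j<Suc i. \<forall>t\<le>k. W x j \<omega> t = (if j < i then (!) (u ! j) else (!) v) t}"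
      using True unfolding past_eq_iff path_eq_iff All_less_Suc by auto
    moreover have "{\<omega> \<in> space M. past x i k \<omega> = u}
        = {\<omega> \<in> space M. \<forall>j<i. \<forall>t\<le>k. W x j \<omega> t = (u ! j) ! t}"
      using True by (auto simp: past_eq_iff)
    ultimately show ?thesis
      using True by (simp add: prob_cylinders)
  next
    case False
    then have disj: "{\<omega> \<in> space M. past x i k \<omega> = u} \<inter> {\<omega> \<in> space M. initial_path x i k \<omega> = v} = {}"
      by (auto simp: past_eq_iff path_eq_iff)
    have "{\<omega> \<in> space M. past x i k \<omega> = u} = {}" if "length v = Suc k"
      using False that by (auto simp: past_eq_iff path_eq_iff)
    then have "length v = Suc k \<Longrightarrow> prob {\<omega> \<in> space M. past x i k \<omega> = u} = 0"
      by (metis measure_empty)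
    then show ?thesis unfolding disj by simp
  qed
  \<comment> \<open>With the past unrestricted the first factor is 1, which identifies
    \<open>?q\<close> as the law of a single path.\<close>
  have "prob ({\<omega> \<in> space M. past x i k \<omega> \<in> UNIV} \<inter> {\<omega> \<in> space M. initial_path x i k \<omega> = v})
      = prob {\<omega> \<in> space M. past x i k \<omega> \<in> UNIV} * ?q"
    by (rule prob_Int_discrete[OF past_measurable countable_pasts _ _ both])
      (auto simp: path_weight_nonneg)
  then show L: "?L = ?q"
    by (simp add: prob_space Int_def cong: conj_cong)
  show "prob {\<omega> \<in> space M. past x i k \<omega> = u \<and> initial_path x i k \<omega> = v}
    = prob {\<omega> \<in> space M. past x i k \<omega> = u} * prob {\<omega> \<in> space M. initial_path x i k \<omega> = v}"
    using both[of u] unfolding L by (simp add: Int_def conj_ac cong: conj_cong)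
qed

lemma prob_past_path:
  "prob ({\<omega> \<in> space M. past x i k \<omega> \<in> A} \<inter> {\<omega> \<in> space M. initial_path x i k \<omega> \<in> B})
    = prob {\<omega> \<in> space M. past x i k \<omega> \<in> A} * prob {\<omega> \<in> space M. initial_path x i k \<omega> \<in> B}"
proof -
  have 1: "prob ({\<omega> \<in> space M. past x i k \<omega> \<in> A} \<inter> {\<omega> \<in> space M. initial_path x i k \<omega> = v})
    = prob {\<omega> \<in> space M. past x i k \<omega> \<in> A} * prob {\<omega> \<in> space M. initial_path x i k \<omega> = v}" for v
    using prob_past_path_eq[of x i k _ v]
    by (intro prob_Int_discrete[OF past_measurable countable_pasts])
      (auto simp: Int_def conj_ac cong: conj_cong)
  have "prob ({\<omega> \<in> space M. initial_path x i k \<omega> \<in> B} \<inter> {\<omega> \<in> space M. past x i k \<omega> \<in> A})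
    = prob {\<omega> \<in> space M. initial_path x i k \<omega> \<in> B} * prob {\<omega> \<in> space M. past x i k \<omega> \<in> A}"
    using 1 by (intro prob_Int_discrete[OF path_measurable countable_paths])
      (auto simp: Int_commute mult.commute)
  then show ?thesis by (simp add: Int_commute mult.commute)
qed

lemma prob_cylinder:
  "prob {\<omega> \<in> space M. \<forall>t\<le>k. W x i \<omega> t = p t} = path_weight x k p"
proof -
  have "{\<omega> \<in> space M. \<forall>t\<le>k. W x i \<omega> t = p t} = {\<omega> \<in> space M. initial_path x i k \<omega> = map p [0..<Suc k]}"
    by (auto simp: path_eq_iff less_Suc_eq_le simp del: upt_Suc)
  moreover have "path_weight x k ((!) (map p [0..<Suc k])) = path_weight x k p"
    by (simp add: path_weight_def less_Suc_eq_le del: upt_Suc)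
  ultimately show ?thesis
    by (simp add: prob_path_eq del: upt_Suc)
qed

lemma AE_path:
  assumes "\<And>v. length v = Suc k \<Longrightarrow> \<not> P v \<Longrightarrow> path_weight x k ((!) v) = 0"
  shows "AE \<omega> in M. P (initial_path x i k \<omega>)"
proof -
  have "AE \<omega> in M. \<forall>v\<in>{v. \<not> P v}. initial_path x i k \<omega> \<noteq> v"
  proof (subst AE_ball_countable)
    show "\<forall>v\<in>{v. \<not> P v}. AE \<omega> in M. initial_path x i k \<omega> \<noteq> v"
    proof
      fix v assume "v \<in> {v. \<not> P v}"
      then have "prob {\<omega> \<in> space M. initial_path x i k \<omega> = v} = 0"
        using assms by (simp add: prob_path_eq)
      then show "AE \<omega> in M. initial_path x i k \<omega> \<noteq> v"
        by (subst AE_iff_measurable[OF _ refl]) (auto simp: emeasure_eq_measure)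
    qed
  qed (rule countable_subset[OF subset_UNIV countable_paths])
  then show ?thesis by eventually_elim auto
qed

lemma AE_start: "AE \<omega> in M. \<forall>i. W x i \<omega> 0 = x"
proof (subst AE_all_countable, rule allI)
  fix i
  have "AE \<omega> in M. (\<lambda>v. v ! 0 = x) (initial_path x i 0 \<omega>)"
    by (rule AE_path) (simp add: path_weight_def)
  then show "AE \<omega> in M. W x i \<omega> 0 = x"
    by (simp add: initial_path_def)
qed

lemma AE_step: "AE \<omega> in M. \<forall>i t. E (W x i \<omega> t) (W x i \<omega> (Suc t))"
proof (subst AE_all_countable, rule allI, subst AE_all_countable, rule allI)
  fix i t
  have "AE \<omega> in M. (\<lambda>v. E (v ! t) (v ! Suc t)) (initial_path x i (Suc t) \<omega>)"
    by (rule AE_path) (auto simp: path_weight_def srw_P_def)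
  moreover have "initial_path x i (Suc t) \<omega> ! t = W x i \<omega> t" "initial_path x i (Suc t) \<omega> ! Suc t = W x i \<omega> (Suc t)" for \<omega>
    by (auto simp: initial_path_def simp del: upt_Suc)
  ultimately show "AE \<omega> in M. E (W x i \<omega> t) (W x i \<omega> (Suc t))"
    by simp
qed

text \<open>Markov property at time \<open>j\<close>. The prefix is arbitrary because the induction
  on the horizon \<open>k\<close> prescribes one more position at each step; the product form of
  \<open>path_weight\<close> then reproduces the recursion of \<open>hit\<close>.\<close>

lemma prob_hit_from_prefix:
  "prob {\<omega> \<in> space M. (\<forall>t\<le>j. W x i \<omega> t = p t) \<and>
      (\<exists>t\<ge>j. t \<le> j + k \<and> W x i \<omega> t \<in> F \<and> (\<forall>s. j \<le> s \<and> s < t \<longrightarrow> W x i \<omega> s \<in> A))}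
    = path_weight x j p * hit k A F (p j)"
proof (induction k arbitrary: j p)
  case 0
  have "{\<omega> \<in> space M. (\<forall>t\<le>j. W x i \<omega> t = p t) \<and>
      (\<exists>t\<ge>j. t \<le> j + 0 \<and> W x i \<omega> t \<in> F \<and> (\<forall>s. j \<le> s \<and> s < t \<longrightarrow> W x i \<omega> s \<in> A))}
     = (if p j \<in> F then {\<omega> \<in> space M. \<forall>t\<le>j. W x i \<omega> t = p t} else {})"
    by auto
  then show ?case by (simp add: prob_cylinder)
next
  case (Suc k)
  define Ev where "Ev j p k = {\<omega> \<in> space M. (\<forall>t\<le>j. W x i \<omega> t = p t) \<and>
      (\<exists>t\<ge>j. t \<le> j + k \<and> W x i \<omega> t \<in> F \<and> (\<forall>s. j \<le> s \<and> s < t \<longrightarrow> W x i \<omega> s \<in> A))}" for j p k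
  have Ev_sets: "Ev j p k \<in> events" for j p k
  proof -
    have [measurable]: "Measurable.pred M (\<lambda>\<omega>. W x i \<omega> t \<in> B)" for t B
      by (rule measurable_compose[OF W_measurable]) simp
    show ?thesis unfolding Ev_def by measurable
  qed
  consider "p j \<in> F" | "p j \<notin> F" "p j \<notin> A" | "p j \<notin> F" "p j \<in> A" by blast
  then have "prob (Ev j p (Suc k)) = path_weight x j p * hit (Suc k) A F (p j)"
  proof cases
    case 1
    have "\<exists>t\<ge>j. t \<le> j + Suc k \<and> W x i \<omega> t \<in> F \<and> (\<forall>s. j \<le> s \<and> s < t \<longrightarrow> W x i \<omega> s \<in> A)"
      if "\<forall>t\<le>j. W x i \<omega> t = p t" for \<omega>
      using that 1 by (intro exI[of _ j]) auto
    then have "Ev j p (Suc k) = {\<omega> \<in> space M. \<forall>t\<le>j. W x i \<omega> t = p t}"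
      unfolding Ev_def by blast
    then show ?thesis using 1 by (simp add: prob_cylinder)
  next
    case 2
    have "Ev j p (Suc k) = {}"
    proof (rule ccontr)
      assume "Ev j p (Suc k) \<noteq> {}"
      then obtain \<omega> t where \<omega>: "\<forall>t\<le>j. W x i \<omega> t = p t" "t \<ge> j" "W x i \<omega> t \<in> F"
        "\<forall>s. j \<le> s \<and> s < t \<longrightarrow> W x i \<omega> s \<in> A"
        unfolding Ev_def by auto
      have "W x i \<omega> j = p j" using \<omega>(1) by simp
      then show False using 2 \<omega>(2-3) \<omega>(4)[rule_format, of j] by (cases "t = j") auto
    qed
    then show ?thesis using 2 by simp
  next
    case 3
    \<comment> \<open>The union over neighbours of \<open>p j\<close> misses the sample points at
      which the walk moves along a non-edge. They form a null set by \<open>AE_step\<close>, so the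
      events are identified almost surely.\<close>
    have eq: "\<omega> \<in> Ev j p (Suc k) \<longleftrightarrow> \<omega> \<in> (\<Union>y\<in>{y. E (p j) y}. Ev (Suc j) (p(Suc j := y)) k)"
      if \<omega>: "\<omega> \<in> space M" and step: "\<forall>i t. E (W x i \<omega> t) (W x i \<omega> (Suc t))" for \<omega>
    proof
      assume L: "\<omega> \<in> Ev j p (Suc k)"
      then obtain t where t: "t \<ge> j" "t \<le> j + Suc k" "W x i \<omega> t \<in> F"
         "\<forall>s. j \<le> s \<and> s < t \<longrightarrow> W x i \<omega> s \<in> A" and p: "\<forall>t\<le>j. W x i \<omega> t = p t"
        unfolding Ev_def by auto
      have "t \<noteq> j" using t p 3 by auto
      then have "Suc j \<le> t" "t \<le> Suc j + k" "\<forall>s. Suc j \<le> s \<and> s < t \<longrightarrow> W x i \<omega> s \<in> A"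
        using t by auto
      moreover have "\<forall>t\<le>Suc j. W x i \<omega> t = (p(Suc j := W x i \<omega> (Suc j))) t"
        using p by (simp add: le_Suc_eq)
      ultimately have "\<omega> \<in> Ev (Suc j) (p(Suc j := W x i \<omega> (Suc j))) k"
        unfolding Ev_def using t(3) \<omega> by blast
      moreover have "E (p j) (W x i \<omega> (Suc j))"
        using step p by (metis order_refl)
      ultimately show "\<omega> \<in> (\<Union>y\<in>{y. E (p j) y}. Ev (Suc j) (p(Suc j := y)) k)"
        by blast
    next
      assume "\<omega> \<in> (\<Union>y\<in>{y. E (p j) y}. Ev (Suc j) (p(Suc j := y)) k)"
      then obtain y t where t: "t \<ge> Suc j" "t \<le> Suc j + k" "W x i \<omega> t \<in> F"
         "\<forall>s. Suc j \<le> s \<and> s < t \<longrightarrow> W x i \<omega> s \<in> A"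
         and p: "\<forall>t\<le>Suc j. W x i \<omega> t = (p(Suc j := y)) t"
        unfolding Ev_def by auto
      have p': "\<forall>t\<le>j. W x i \<omega> t = p t"
        using p by auto
      have "\<forall>s. j \<le> s \<and> s < t \<longrightarrow> W x i \<omega> s \<in> A"
      proof (intro allI impI)
        fix s assume s: "j \<le> s \<and> s < t"
        show "W x i \<omega> s \<in> A"
          using s t(4) p' 3 by (cases "s = j") auto
      qed
      then show "\<omega> \<in> Ev j p (Suc k)"
        unfolding Ev_def using t p' \<omega> by (intro CollectI conjI exI[of _ t]) auto
    qed
    have "prob (Ev j p (Suc k)) = prob (\<Union>y\<in>{y. E (p j) y}. Ev (Suc j) (p(Suc j := y)) k)"
    proof (rule measure_eq_AE)
      show "AE \<omega> in M. (\<omega> \<in> Ev j p (Suc k)) = (\<omega> \<in> (\<Union>y\<in>{y. E (p j) y}. Ev (Suc j) (p(Suc j := y)) k))"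
        using AE_step[of x] AE_space by eventually_elim (rule eq)
    qed (use Ev_sets finite_neighbours in auto)
    also have "\<dots> = (\<Sum>y | E (p j) y. prob (Ev (Suc j) (p(Suc j := y)) k))"
      using finite_neighbours Ev_sets
    proof (intro finite_measure_finite_Union)
      show "disjoint_family_on (\<lambda>y. Ev (Suc j) (p(Suc j := y)) k) {y. E (p j) y}"
        unfolding disjoint_family_on_def
      proof (intro ballI impI)
        fix y z :: 'a assume "y \<noteq> z"
        then have "W x i \<omega> (Suc j) = y \<Longrightarrow> W x i \<omega> (Suc j) = z \<Longrightarrow> False" for \<omega> by simp
        moreover have "\<omega> \<in> Ev (Suc j) (p(Suc j := y)) k \<Longrightarrow> W x i \<omega> (Suc j) = y" for \<omega> and y :: 'a
          unfolding Ev_def by simp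
        ultimately show "Ev (Suc j) (p(Suc j := y)) k \<inter> Ev (Suc j) (p(Suc j := z)) k = {}"
          by blast
      qed
    qed auto
    also have "\<dots> = (\<Sum>y | E (p j) y. path_weight x (Suc j) (p(Suc j := y)) * hit k A F y)"
      unfolding Ev_def by (simp only: Suc fun_upd_same)
    also have "\<dots> = (\<Sum>y | E (p j) y. path_weight x j p * (srw_P E (p j) y * hit k A F y))"
      by (intro sum.cong refl) (simp add: path_weight_def)
    also have "\<dots> = path_weight x j p * hit (Suc k) A F (p j)"
      using 3 by (simp add: sum_distrib_left)
    finally show ?thesis .
  qed
  then show ?case unfolding Ev_def .
qed

lemma hits_measurable[measurable]:
  assumes [measurable]: "\<And>t. (\<lambda>\<omega>. w \<omega> t) \<in> measurable N (count_space UNIV)"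
  shows "Measurable.pred N (\<lambda>\<omega>. hits A F (w \<omega>))"
proof -
  have [measurable]: "Measurable.pred N (\<lambda>\<omega>. w \<omega> t \<in> B)" for t B
    by (rule measurable_compose[OF assms]) simp
  show ?thesis unfolding hits_def by measurable
qed

lemma prob_hits: "prob {\<omega> \<in> space M. hits A F (W x i \<omega>)} = hit_prob A F x"
proof -
  define Ev where "Ev k = {\<omega> \<in> space M. W x i \<omega> 0 = x \<and> (\<exists>t\<le>k. W x i \<omega> t \<in> F \<and> (\<forall>s<t. W x i \<omega> s \<in> A))}" for k
  have Ev_sets: "Ev k \<in> events" for k
  proof -
    have [measurable]: "Measurable.pred M (\<lambda>\<omega>. W x i \<omega> t \<in> B)" for t B
      by (rule measurable_compose[OF W_measurable]) simp
    show ?thesis unfolding Ev_def by measurable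
  qed
  have "prob (Ev k) = hit k A F x" for k
    using prob_hit_from_prefix[of 0 x i "\<lambda>_. x" k F A] by (simp add: Ev_def path_weight_def)
  moreover have "(\<lambda>k. prob (Ev k)) \<longlonglongrightarrow> prob (\<Union>k. Ev k)"
    
  proof (rule finite_Lim_measure_incseq)
    show "incseq Ev"
      unfolding incseq_def Ev_def using order_trans by blast
  qed (use Ev_sets in auto)
  ultimately have "prob (\<Union>k. Ev k) = hit_prob A F x"
    using LIMSEQ_unique[OF hit_tendsto] by simp
  moreover have "prob {\<omega> \<in> space M. hits A F (W x i \<omega>)} = prob (\<Union>k. Ev k)"
  proof (rule measure_eq_AE)
    show "AE \<omega> in M. (\<omega> \<in> {\<omega> \<in> space M. hits A F (W x i \<omega>)}) = (\<omega> \<in> (\<Union>k. Ev k))"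
      using AE_start[of x] AE_space
    proof eventually_elim
      case (elim \<omega>)
      then have "\<omega> \<in> (\<Union>k. Ev k) \<longleftrightarrow> (\<exists>t. W x i \<omega> t \<in> F \<and> (\<forall>s<t. W x i \<omega> s \<in> A))"
        unfolding Ev_def by blast
      then show ?case using elim by (simp add: hits_def)
    qed
  qed (use Ev_sets in auto)
  ultimately show ?thesis by simp
qed

section \<open>Independence of a new walk from all that the earlier walks generate\<close>

lemma path_mono: "k \<le> K \<Longrightarrow> initial_path x i k \<omega> = take (Suc k) (initial_path x i K \<omega>)"
  by (simp add: initial_path_def take_map take_upt del: upt_Suc)

lemma past_mono: "k \<le> K \<Longrightarrow> past x m k \<omega> = map (take (Suc k)) (past x m K \<omega>)"
  by (simp add: past_def path_mono[of k K])

definition past_events :: "'a \<Rightarrow> nat \<Rightarrow> 'w set set" where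
  "past_events x m = {{\<omega> \<in> space M. past x m k \<omega> \<in> A} | k A. True}"

definition path_events :: "'a \<Rightarrow> nat \<Rightarrow> 'w set set" where
  "path_events x m = {{\<omega> \<in> space M. initial_path x m k \<omega> \<in> A} | k A. True}"

text \<open>Exit times are unbounded, so a cluster is not determined by the past up to a fixed
  horizon; hence the generated sigma-algebras. Truncating lists lifts two horizons to their maximum,
  which yields both stability under intersections and the common horizon of
  \<open>prob_past_path\<close>.\<close>

lemma indep_past_path:
  "indep_set (sigma_sets (space M) (past_events x m)) (sigma_sets (space M) (path_events x m))"
proof (rule indep_set_sigma_sets)
  have lift1: "{\<omega> \<in> space M. past x m k \<omega> \<in> A} = {\<omega> \<in> space M. past x m K \<omega> \<in> {u. map (take (Suc k)) u \<in> A}}"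
    if "k \<le> K" for k K A
    using past_mono[OF that] by simp
  have lift2: "{\<omega> \<in> space M. initial_path x m k \<omega> \<in> A} = {\<omega> \<in> space M. initial_path x m K \<omega> \<in> {u. take (Suc k) u \<in> A}}"
    if "k \<le> K" for k K A
    using path_mono[OF that] by simp
  show "indep_set (past_events x m) (path_events x m)"
  proof (rule indep_setI)
    show "past_events x m \<subseteq> events"
      by (auto simp: past_events_def)
    show "path_events x m \<subseteq> events"
      by (auto simp: path_events_def)
    fix a b assume "a \<in> past_events x m" "b \<in> path_events x m"
    then obtain k A l B where ab: "a = {\<omega> \<in> space M. past x m k \<omega> \<in> A}" "b = {\<omega> \<in> space M. initial_path x m l \<omega> \<in> B}"
      unfolding past_events_def path_events_def by auto
    show "prob (a \<inter> b) = prob a * prob b"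
      unfolding ab lift1[of k "max k l", OF max.cobounded1] lift2[of l "max k l", OF max.cobounded2]
      by (rule prob_past_path)
  qed
  show "Int_stable (past_events x m)"
  proof (rule Int_stableI)
    fix a b assume "a \<in> past_events x m" "b \<in> past_events x m"
    then obtain k A l B where ab: "a = {\<omega> \<in> space M. past x m k \<omega> \<in> A}" "b = {\<omega> \<in> space M. past x m l \<omega> \<in> B}"
      unfolding past_events_def by auto
    have "a \<inter> b = {\<omega> \<in> space M. past x m (max k l) \<omega> \<in> {u. map (take (Suc k)) u \<in> A} \<inter> {u. map (take (Suc l)) u \<in> B}}"
      unfolding ab lift1[of k "max k l", OF max.cobounded1] lift1[of l "max k l", OF max.cobounded2] by auto
    then show "a \<inter> b \<in> past_events x m" unfolding past_events_def by blast
  qed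
  show "Int_stable (path_events x m)"
  proof (rule Int_stableI)
    fix a b assume "a \<in> path_events x m" "b \<in> path_events x m"
    then obtain k A l B where ab: "a = {\<omega> \<in> space M. initial_path x m k \<omega> \<in> A}" "b = {\<omega> \<in> space M. initial_path x m l \<omega> \<in> B}"
      unfolding path_events_def by auto
    have "a \<inter> b = {\<omega> \<in> space M. initial_path x m (max k l) \<omega> \<in> {u. take (Suc k) u \<in> A} \<inter> {u. take (Suc l) u \<in> B}}"
      unfolding ab lift2[of k "max k l", OF max.cobounded1] lift2[of l "max k l", OF max.cobounded2] by auto
    then show "a \<inter> b \<in> path_events x m" unfolding path_events_def by blast
  qed
qed

lemma W_measurable_past:
  assumes "i < m"
  shows "(\<lambda>\<omega>. W x i \<omega> t) \<in> measurable (sigma (space M) (past_events x m)) (count_space UNIV)"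
proof -
  have sub: "past_events x m \<subseteq> Pow (space M)" by (auto simp: past_events_def)
  have "(\<lambda>\<omega>. W x i \<omega> t) -` {a} \<inter> space M = {\<omega> \<in> space M. past x m t \<omega> \<in> {u. u ! i ! t = a}}" for a
    using assms by (auto simp: past_def initial_path_def simp del: upt_Suc)
  then have "(\<lambda>\<omega>. W x i \<omega> t) -` {a} \<inter> space M \<in> past_events x m" for a
    unfolding past_events_def by blast
  then show ?thesis
    using sub by (subst measurable_count_space_eq_countable[OF countable_vertices])
      (auto simp: sets_measure_of space_measure_of)
qed

lemma W_measurable_path:
  "(\<lambda>\<omega>. W x m \<omega> t) \<in> measurable (sigma (space M) (path_events x m)) (count_space UNIV)"
proof -
  have sub: "path_events x m \<subseteq> Pow (space M)" by (auto simp: path_events_def)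
  have "(\<lambda>\<omega>. W x m \<omega> t) -` {a} \<inter> space M = {\<omega> \<in> space M. initial_path x m t \<omega> \<in> {u. u ! t = a}}" for a
    by (auto simp: initial_path_def simp del: upt_Suc)
  then have "(\<lambda>\<omega>. W x m \<omega> t) -` {a} \<inter> space M \<in> path_events x m" for a
    unfolding path_events_def by blast
  then show ?thesis
    using sub by (subst measurable_count_space_eq_countable[OF countable_vertices])
      (auto simp: sets_measure_of space_measure_of)
qed

section \<open>Measurability of the clusters, whose values form a countable set\<close>

lemma countable_finite_sets: "countable {S :: 'a set. finite S}"
  using countable_Collect_finite_subset[OF countable_vertices] by simp

lemma exit_time_measurable:
  assumes [measurable]: "\<And>t. (\<lambda>\<omega>. w \<omega> t) \<in> measurable N (count_space UNIV)"
  shows "(\<lambda>\<omega>. exit_time S (w \<omega>)) \<in> measurable N (count_space UNIV)"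
proof -
  have [measurable]: "Measurable.pred N (\<lambda>\<omega>. w \<omega> t \<notin> B)" for t B
    by (rule measurable_compose[OF assms]) simp
  show ?thesis unfolding exit_time_def by measurable
qed

lemma insert_measurable:
  assumes w: "\<And>t. (\<lambda>\<omega>. w \<omega> t) \<in> measurable N (count_space UNIV)"
    and \<tau>: "\<tau> \<in> measurable N (count_space (UNIV :: nat set))" and S: "finite S"
  shows "(\<lambda>\<omega>. insert (w \<omega> (\<tau> \<omega>)) S) \<in> measurable N (count_space {S :: 'a set. finite S})"
proof -
  have "(\<lambda>\<omega>. w \<omega> (\<tau> \<omega>)) \<in> measurable N (count_space UNIV)"
    by (rule measurable_compose_countable[OF w \<tau>])
  then show ?thesis
    by (rule measurable_compose) (use S in simp)
qed

text \<open>As the previous cluster has countably many possible values, it can be held constant when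
  measurability of a step is checked. \<open>N\<close> is general so that it can also be the
  sigma-algebra of the past.\<close>

lemma idla_measurable:
  assumes "\<And>i t. i < m \<Longrightarrow> (\<lambda>\<omega>. w i \<omega> t) \<in> measurable N (count_space UNIV)"
  shows "(\<lambda>\<omega>. idla (\<lambda>i. w i \<omega>) m) \<in> measurable N (count_space {S :: 'a set. finite S})"
  using assms
proof (induction m)
  case (Suc m)
  have "(\<lambda>\<omega>. idla_step (idla (\<lambda>i. w i \<omega>) m) (w m \<omega>)) \<in> measurable N (count_space {S. finite S})"
    unfolding idla_step_def
    by (rule measurable_compose_countable'[OF _ Suc.IH countable_finite_sets],
      rule insert_measurable, assumption?)
      (use Suc.prems in \<open>auto intro!: exit_time_measurable\<close>)
  then show ?case by simp
qed simp

lemma idla_paused_measurable: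
  assumes "\<And>i t. i < m \<Longrightarrow> (\<lambda>\<omega>. w i \<omega> t) \<in> measurable N (count_space UNIV)"
  shows "(\<lambda>\<omega>. idla_paused T (\<lambda>i. w i \<omega>) m) \<in> measurable N (count_space {S :: 'a set. finite S})"
  using assms
proof (induction m)
  case (Suc m)
  have [measurable]: "(\<lambda>\<omega>. exit_time S (w m \<omega>)) \<in> measurable N (count_space UNIV)" for S
    using Suc.prems by (intro exit_time_measurable) auto
  have "(\<lambda>\<omega>. idla_step_paused T (idla_paused T (\<lambda>i. w i \<omega>) m) (w m \<omega>))
      \<in> measurable N (count_space {S. finite S})"
    unfolding idla_step_paused_def
    by (rule measurable_compose_countable'[OF _ Suc.IH countable_finite_sets],
      rule insert_measurable)
      (use Suc.prems in auto)
  then show ?case by simp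
qed simp

text \<open>Walks are numbered from 0, so the cluster of size parameter \<open>m\<close> depends on
  the walks below \<open>m\<close> only, and walk \<open>m\<close> is fresh given this
  cluster.\<close>

lemma prob_idla_hits:
  assumes "finite S"
  shows "prob ({\<omega> \<in> space M. idla (\<lambda>i. W x i \<omega>) m = S} \<inter> {\<omega> \<in> space M. hits A F (W x m \<omega>)})
    = prob {\<omega> \<in> space M. idla (\<lambda>i. W x i \<omega>) m = S} * hit_prob A F x"
proof -
  let ?N = "sigma (space M) (past_events x m)" and ?L = "sigma (space M) (path_events x m)"
  have sub: "past_events x m \<subseteq> Pow (space M)" "path_events x m \<subseteq> Pow (space M)"
    by (auto simp: past_events_def path_events_def)
  have "(\<lambda>\<omega>. idla (\<lambda>i. W x i \<omega>) m) \<in> measurable ?N (count_space {S. finite S})"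
    by (intro idla_measurable W_measurable_past)
  from measurable_sets[OF this, of "{S}"]
  have 1: "{\<omega> \<in> space M. idla (\<lambda>i. W x i \<omega>) m = S} \<in> sigma_sets (space M) (past_events x m)"
    using assms sub by (simp add: vimage_def Int_def conj_commute sets_measure_of space_measure_of)
  have "Measurable.pred ?L (\<lambda>\<omega>. hits A F (W x m \<omega>))"
    by (intro hits_measurable W_measurable_path)
  then have 2: "{\<omega> \<in> space M. hits A F (W x m \<omega>)} \<in> sigma_sets (space M) (path_events x m)"
    using sub by (simp add: pred_def sets_measure_of space_measure_of)
  show ?thesis
    using indep_setD[OF indep_past_path 1 2] by (simp add: prob_hits)
qed

end

section \<open>Pathwise properties of the clusters\<close>

lemma finite_idla: "finite (idla ps m)"
  by (induction m) (auto simp: idla_step_def)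

lemma card_idla_le: "card (idla ps m) \<le> m"
  by (induction m) (auto simp: idla_step_def card_insert_if finite_idla)

lemma exit_time_eq:
  assumes "p t \<notin> S" "\<And>s. s < t \<Longrightarrow> p s \<in> S"
  shows "exit_time S p = t"
  unfolding exit_time_def
proof (rule Least_equality)
  show "t \<le> s" if "p s \<notin> S" for s
    using that assms(2)[of s] not_less by blast
qed (rule assms(1))

text \<open>No number below a \<open>LEAST\<close> has the property, whether or not a witness
  exists. This is why the pathwise arguments also cover walks that never leave
  \<open>S\<close>.\<close>

lemma in_before_exit_time: "s < exit_time S p \<Longrightarrow> p s \<in> S"
  unfolding exit_time_def using not_less_Least[of s "\<lambda>t. p t \<notin> S"] by blast

lemma idla_step_hits:
  assumes "hits S F p" "F \<inter> S = {}"
  obtains v where "v \<in> F" "idla_step S p = insert v S"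
proof -
  obtain t where t: "p t \<in> F" "\<forall>s<t. p s \<in> S" using assms(1) unfolding hits_def by blast
  then have "exit_time S p = t"
    using assms(2) by (intro exit_time_eq[of p]) auto
  with t show ?thesis
    by (intro that[of "p t"]) (simp_all add: idla_step_def)
qed

lemma hits_idla_step:
  assumes "idla_step S p = insert v S" "v \<notin> S" "v \<in> F"
  shows "hits S F p"
proof -
  have "v \<in> idla_step S p" using assms(1) by simp
  then have "p (exit_time S p) = v" using assms(2) by (simp add: idla_step_def)
  then show ?thesis
    unfolding hits_def using assms(3) in_before_exit_time[of _ S p]
    by (intro exI[of _ "exit_time S p"]) simp
qed

text \<open>Translates the growth of the cluster into an event of the walk with probability
  \<open>hit_prob\<close>. A walk that never leaves \<open>S\<close> adds nothing new, and then both
  sides are false.\<close>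

lemma hits_iff:
  assumes "F \<inter> S = {}" "idla_step S p = insert v S"
  shows "hits S F p \<longleftrightarrow> v \<in> F"
proof
  assume "hits S F p"
  from idla_step_hits[OF this assms(1)] obtain w where w: "w \<in> F" "idla_step S p = insert w S" .
  then have "w \<in> insert v S" using assms(2) by simp
  then show "v \<in> F" using w(1) assms(1) by blast
next
  assume "v \<in> F"
  then show "hits S F p" using assms by (intro hits_idla_step) auto
qed

lemma hits_first_entrance:
  assumes "p s \<in> F" "\<And>r. r < s \<Longrightarrow> p r \<in> T"
  shows "hits (T - F) F p"
proof -
  define t where "t = (LEAST t. p t \<in> F)"
  have "p t \<in> F"
    unfolding t_def by (rule LeastI[of "\<lambda>t. p t \<in> F"]) (rule assms(1))
  moreover have "t \<le> s"
    unfolding t_def by (rule Least_le) (rule assms(1))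
  moreover have "p r \<notin> F" if "r < t" for r
    by (rule not_less_Least[of r "\<lambda>t. p t \<in> F"]) (use that in \<open>simp add: t_def\<close>)
  moreover have "p r \<in> T" if "r < t" for r
    using that \<open>t \<le> s\<close> by (intro assms(2)) simp
  ultimately show ?thesis
    unfolding hits_def by (intro exI[of _ t]) simp
qed

text \<open>The subtraction is truncated: if \<open>exit_time T p\<close> is 0, the bound still
  admits \<open>r = 0\<close>, which is covered by the start in \<open>T\<close>. Any other
  \<open>r\<close> lies strictly before the exit.\<close>

lemma paused_time_in:
  assumes "r \<le> exit_time T p - 1" "p 0 \<in> T"
  shows "p r \<in> T"
  using assms in_before_exit_time[of r T p] by (cases "r = 0") auto

lemma finite_idla_paused: "finite (idla_paused T ps m)"
  by (induction m) (auto simp: idla_step_paused_def)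

lemma idla_paused_subset:
  assumes "\<And>i. i < m \<Longrightarrow> ps i 0 \<in> T"
  shows "idla_paused T ps m \<subseteq> T"
  using assms
proof (induction m)
  case (Suc m)
  let ?s = "min (exit_time (idla_paused T ps m) (ps m)) (exit_time T (ps m) - 1)"
  have "ps m ?s \<in> T"
    using Suc.prems[of m] by (intro paused_time_in[of ?s T "ps m"]) simp_all
  then show ?case using Suc by (simp add: idla_step_paused_def)
qed simp

text \<open>Before it stops, the particle of the smaller cluster has stayed in \<open>S'\<close>,
  hence in \<open>S\<close>. Its final position therefore lies in \<open>S\<close> or is also the
  first exit from \<open>S\<close>.\<close>

lemma idla_step_paused_subset_step:
  assumes "S' \<subseteq> S"
  shows "idla_step_paused T S' p \<subseteq> idla_step S p"
proof -
  let ?e = "exit_time S' p" and ?s = "min (exit_time S' p) (exit_time T p - 1)"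
  have "p ?s \<in> idla_step S p"
  proof (cases "?s = ?e \<and> p ?e \<notin> S")
    case True
    then have "exit_time S p = ?e"
      using assms in_before_exit_time[of _ S' p] by (intro exit_time_eq[of p]) auto
    then show ?thesis using True by (simp add: idla_step_def)
  next
    case False
    then have "p ?s \<in> S"
      using in_before_exit_time[of ?s S' p] assms by (cases "?s < ?e") (auto simp: min_def split: if_splits)
    then show ?thesis by (simp add: idla_step_def)
  qed
  then show ?thesis using assms by (auto simp: idla_step_paused_def idla_step_def)
qed

lemma idla_paused_subset_idla: "idla_paused T ps m \<subseteq> idla ps m"
  by (induction m) (auto dest: subsetD[OF idla_step_paused_subset_step])

text \<open>Each explorer occupies at most one new point of \<open>F\<close>.\<close>

lemma card_idla_paused_Int_le:
  assumes "\<And>i. i < m \<Longrightarrow> ps i 0 \<in> T"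
  shows "card (F \<inter> idla_paused T ps m) \<le> card {i. i < m \<and> hits (T - F) F (ps i)}"
  using assms
proof (induction m)
  case (Suc m)
  define S where "S = idla_paused T ps m"
  let ?p = "ps m" and ?s = "min (exit_time S (ps m)) (exit_time T (ps m) - 1)"
  have IH: "card (F \<inter> S) \<le> card {i. i < m \<and> hits (T - F) F (ps i)}"
    unfolding S_def using Suc by simp
  have fin: "finite S" unfolding S_def by (rule finite_idla_paused)
  have eq: "idla_paused T ps (Suc m) = insert (?p ?s) S"
    by (simp add: idla_step_paused_def S_def)
  show ?case
  proof (cases "?p ?s \<in> F")
    case True
    have "?p r \<in> T" if "r < ?s" for r
      using that Suc.prems[of m] by (intro paused_time_in[of r T ?p]) simp_all
    with True have "hits (T - F) F ?p"
      by (rule hits_first_entrance[of ?p])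
    then have "{i. i < Suc m \<and> hits (T - F) F (ps i)} = insert m {i. i < m \<and> hits (T - F) F (ps i)}"
      by (auto simp: less_Suc_eq)
    moreover have "card (F \<inter> insert (?p ?s) S) \<le> Suc (card (F \<inter> S))"
      using True fin by (simp add: card_insert_if)
    ultimately show ?thesis using IH unfolding eq by simp
  next
    case False
    have "card {i. i < m \<and> hits (T - F) F (ps i)} \<le> card {i. i < Suc m \<and> hits (T - F) F (ps i)}"
      by (intro card_mono) auto
    then show ?thesis using IH False unfolding eq by simp
  qed
qed simp

context srw_walks
begin

lemma hits_in_sets[measurable]: "{\<omega> \<in> space M. hits A F (W x i \<omega>)} \<in> events"
  using hits_measurable[OF W_measurable] by (simp add: pred_def)

lemma idla_eq_in_sets[measurable]: "{\<omega> \<in> space M. P (idla (\<lambda>i. W x i \<omega>) m)} \<in> events"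
proof -
  have "(\<lambda>\<omega>. idla (\<lambda>i. W x i \<omega>) m) \<in> measurable M (count_space {S. finite S})"
    by (intro idla_measurable) simp
  from measurable_sets[OF this , of "{S. finite S \<and> P S}"] show ?thesis
    by (simp add: vimage_def Int_def conj_commute finite_idla Collect_mono)
qed

lemma idla_paused_in_sets[measurable]:
  "{\<omega> \<in> space M. P (idla_paused T (\<lambda>i. W x i \<omega>) m)} \<in> events"
proof -
  have "(\<lambda>\<omega>. idla_paused T (\<lambda>i. W x i \<omega>) m) \<in> measurable M (count_space {S. finite S})"
    by (intro idla_paused_measurable) simp
  from measurable_sets[OF this , of "{S. finite S \<and> P S}"] show ?thesis
    by (simp add: vimage_def Int_def conj_commute finite_idla_paused Collect_mono)
qed

subsection \<open>Absorption and escape probabilities\<close>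

lemma integrable_event: "A \<in> events \<Longrightarrow> integrable M (indicat_real A)"
  by (simp add: integrable_real_indicator emeasure_eq_measure)

text \<open>On the covering event at least \<open>card F\<close> explorers enter \<open>F\<close>
  through \<open>T - F\<close>; by linearity of expectation the mean number of explorers that do so
  is the right-hand side.\<close>

lemma cover_prob_le_hit_prob:
  assumes "x \<in> T" "F \<subseteq> T"
  shows "real (card F) * prob {\<omega> \<in> space M. T \<subseteq> idla_paused T (\<lambda>i. W x i \<omega>) m}
    \<le> real m * hit_prob (T - F) F x"
proof -
  let ?C = "{\<omega> \<in> space M. T \<subseteq> idla_paused T (\<lambda>i. W x i \<omega>) m}"
  let ?H = "\<lambda>i. {\<omega> \<in> space M. hits (T - F) F (W x i \<omega>)}"
  have "real (card F) * prob ?C = (\<integral>\<omega>. real (card F) * indicator ?C \<omega> \<partial>M)"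
    by (simp add: integrable_event)
  also have "\<dots> \<le> (\<integral>\<omega>. (\<Sum>i<m. indicator (?H i) \<omega>) \<partial>M)"
  proof (rule integral_mono_AE)
    show "AE \<omega> in M. real (card F) * indicator ?C \<omega> \<le> (\<Sum>i<m. indicator (?H i) \<omega>)"
      using AE_start[of x] AE_space
    proof eventually_elim
      case (elim \<omega>)
      have "real (card F) \<le> (\<Sum>i<m. indicator (?H i) \<omega>)" if "T \<subseteq> idla_paused T (\<lambda>i. W x i \<omega>) m"
      proof -
        have "F \<inter> idla_paused T (\<lambda>i. W x i \<omega>) m = F" using that assms by auto
        then have "card F \<le> card {i. i < m \<and> hits (T - F) F (W x i \<omega>)}"
          using card_idla_paused_Int_le[of m "\<lambda>i. W x i \<omega>" T F] elim assms by simp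
        also have "{i. i < m \<and> hits (T - F) F (W x i \<omega>)} = {i\<in>{..<m}. \<omega> \<in> ?H i}"
          using elim by auto
        also have "real (card \<dots>) = (\<Sum>i<m. indicator (?H i) \<omega>)"
          by (simp add: indicator_def of_bool_def sum.If_cases Int_def)
        finally show ?thesis by simp
      qed
      then show ?case by (auto simp: indicator_def intro!: sum_nonneg)
    qed
  qed (auto intro!: integrable_event)
  also have "\<dots> = (\<Sum>i<m. prob (?H i))"
    by (subst Bochner_Integration.integral_sum) (auto intro!: integrable_event)
  also have "\<dots> = real m * hit_prob (T - F) F x"
    by (simp add: prob_hits)
  finally show ?thesis .
qed

text \<open>Given the current cluster \<open>S\<close>, the growth factor in \<open>step\<close> has
  a mean of at most 1 by \<open>drift\<close>, and \<open>b \<le> 1\<close> keeps it nonnegative.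
  Conditioning is a sum over all finite \<open>S\<close>, exchanged with the integral. Asking
  \<open>drift\<close> only where \<open>f\<close> is nonzero admits weights with a cutoff.\<close>

lemma idla_supermartingale:
  fixes f :: "'a set \<Rightarrow> real" and F F' :: "'a set \<Rightarrow> 'a set" and a b :: real
  assumes f: "\<And>S. 0 \<le> f S" and b: "b \<le> 1"  and a: "0 \<le> a"
    and step: "\<And>S p. finite S \<Longrightarrow> f (idla_step S p)
      \<le> f S * (1 + a * of_bool (hits S (F S) p) - b * of_bool (hits S (F' S) p))"
    and drift: "\<And>S. finite S \<Longrightarrow> f S \<noteq> 0 \<Longrightarrow> a * hit_prob S (F S) x \<le> b * hit_prob S (F' S) x"
  shows "(\<integral>\<^sup>+\<omega>. ennreal (f (idla (\<lambda>i. W x i \<omega>) m)) \<partial>M) \<le> ennreal (f {})"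
proof (induction m)
  case 0
  then show ?case by (simp add: emeasure_space_1)
next
  case (Suc m)
  let ?S = "\<lambda>\<omega>. idla (\<lambda>i. W x i \<omega>) m"
  let ?fin = "{S :: 'a set. finite S}"
  let ?I = "\<lambda>S. {\<omega> \<in> space M. ?S \<omega> = S}"
  have [measurable]: "(\<lambda>\<omega>. f (idla_step S (W x m \<omega>))) \<in> borel_measurable M" if "finite S" for S
  proof -
    have "(\<lambda>\<omega>. idla_step S (W x m \<omega>)) \<in> measurable M (count_space ?fin)"
      unfolding idla_step_def by (intro insert_measurable exit_time_measurable that) simp_all
    then show ?thesis by (rule measurable_compose) simp
  qed
  \<comment> \<open>At a fixed sample point only the term of the current cluster survives in the sum
    over all finite \<open>S\<close>.\<close>
  have single: "(\<integral>\<^sup>+S. g S * indicator (?I S) \<omega> \<partial>count_space ?fin) = g (?S \<omega>)"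
    if "\<omega> \<in> space M" for \<omega> and g :: "'a set \<Rightarrow> ennreal"
  proof -
    have "(\<integral>\<^sup>+S. g S * indicator (?I S) \<omega> \<partial>count_space ?fin)
        = (\<integral>\<^sup>+S. g (?S \<omega>) * indicator {?S \<omega>} S \<partial>count_space ?fin)"
      using that by (intro nn_integral_cong) (auto simp: indicator_def)
    also have "\<dots> = g (?S \<omega>)"
      by (simp add: nn_integral_cmult_indicator finite_idla)
    finally show ?thesis .
  qed
  have "(\<integral>\<^sup>+\<omega>. ennreal (f (idla (\<lambda>i. W x i \<omega>) (Suc m))) \<partial>M)
    = (\<integral>\<^sup>+\<omega>. \<integral>\<^sup>+S. ennreal (f (idla_step S (W x m \<omega>))) * indicator (?I S) \<omega> \<partial>count_space ?fin \<partial>M)"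
    by (intro nn_integral_cong) (subst single, auto)
  also have "\<dots> = (\<integral>\<^sup>+S. \<integral>\<^sup>+\<omega>. ennreal (f (idla_step S (W x m \<omega>))) * indicator (?I S) \<omega> \<partial>M \<partial>count_space ?fin)"
    by (intro nn_integral_count_space_nn_integral countable_finite_sets) auto
  also have "\<dots> \<le> (\<integral>\<^sup>+S. \<integral>\<^sup>+\<omega>. ennreal (f S) * indicator (?I S) \<omega> \<partial>M \<partial>count_space ?fin)"
  proof (rule nn_integral_mono)
    fix S assume "S \<in> space (count_space ?fin)"
    then have S: "finite S" by simp
    let ?Y = "{\<omega> \<in> space M. hits S (F S) (W x m \<omega>)}" and ?Z = "{\<omega> \<in> space M. hits S (F' S) (W x m \<omega>)}"
    let ?g = "\<lambda>\<omega>. f S * (indicator (?I S) \<omega> + a * indicator (?I S \<inter> ?Y) \<omega> - b * indicator (?I S \<inter> ?Z) \<omega>)"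
    have int: "integrable M (indicat_real (?I S))" "integrable M (indicat_real (?I S \<inter> ?Y))"
      "integrable M (indicat_real (?I S \<inter> ?Z))"
      by (auto intro!: integrable_event)
    have g_nonneg: "0 \<le> ?g \<omega>" for \<omega>
      using f[of S] a b by (intro mult_nonneg_nonneg) (auto simp: indicator_def)
    have "(\<integral>\<^sup>+\<omega>. ennreal (f (idla_step S (W x m \<omega>))) * indicator (?I S) \<omega> \<partial>M) \<le> (\<integral>\<^sup>+\<omega>. ennreal (?g \<omega>) \<partial>M)"
    proof (rule nn_integral_mono)
      fix \<omega> assume "\<omega> \<in> space M"
      then show "ennreal (f (idla_step S (W x m \<omega>))) * indicator (?I S) \<omega> \<le> ennreal (?g \<omega>)"
        using step[OF S, of "W x m \<omega>"] by (cases "?S \<omega> = S") (auto simp: indicator_def intro!: ennreal_leI)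
    qed
    also have "\<dots> = ennreal (\<integral>\<omega>. ?g \<omega> \<partial>M)"
      using g_nonneg int by (intro nn_integral_eq_integral) auto
    finally have "(\<integral>\<^sup>+\<omega>. ennreal (f (idla_step S (W x m \<omega>))) * indicator (?I S) \<omega> \<partial>M)
      \<le> ennreal (\<integral>\<omega>. ?g \<omega> \<partial>M)" .
    moreover have "(\<integral>\<omega>. ?g \<omega> \<partial>M) \<le> prob (?I S) * f S"
    proof -
      have "(\<integral>\<omega>. ?g \<omega> \<partial>M) = f S * (prob (?I S) + a * prob (?I S \<inter> ?Y) - b * prob (?I S \<inter> ?Z))"
        using int by simp
      also have "\<dots> = prob (?I S) * (f S * (1 + a * hit_prob S (F S) x - b * hit_prob S (F' S) x))"
        by (simp add: prob_idla_hits[OF S] algebra_simps)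
      also have "\<dots> \<le> prob (?I S) * f S"
        using drift[OF S] f[of S] by (intro mult_left_mono) (cases "f S = 0", auto intro: mult_left_le)
      finally show ?thesis .
    qed
    ultimately have "(\<integral>\<^sup>+\<omega>. ennreal (f (idla_step S (W x m \<omega>))) * indicator (?I S) \<omega> \<partial>M)
      \<le> ennreal (prob (?I S) * f S)"
      using ennreal_leI order_trans by blast
    then show "(\<integral>\<^sup>+\<omega>. ennreal (f (idla_step S (W x m \<omega>))) * indicator (?I S) \<omega> \<partial>M)
       \<le> (\<integral>\<^sup>+\<omega>. ennreal (f S) * indicator (?I S) \<omega> \<partial>M)"
      using f[of S] by (simp add: nn_integral_cmult_indicator emeasure_eq_measure mult.commute flip: ennreal_mult)
  qed
  also have "\<dots> = (\<integral>\<^sup>+\<omega>. \<integral>\<^sup>+S. ennreal (f S) * indicator (?I S) \<omega> \<partial>count_space ?fin \<partial>M)"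
    by (intro nn_integral_count_space_nn_integral[symmetric] countable_finite_sets) auto
  also have "\<dots> = (\<integral>\<^sup>+\<omega>. ennreal (f (?S \<omega>)) \<partial>M)"
    by (intro nn_integral_cong) (rule single)
  finally show ?case using Suc by simp
qed

text \<open>The weight is cut off to 0 once more than \<open>k\<close> points lie outside
  \<open>B\<close>. This replaces a stopping time: the number of such points never decreases, so a
  weight 0 remains 0, and wherever the weight is nonzero \<open>bdry\<close> applies. The conclusion
  is Markov's inequality for a weight with initial value 1.\<close>

lemma idla_escape_prob:
  fixes \<delta> k :: real
  assumes sub: "B \<subseteq> B'" "D \<subseteq> B'" and x: "x \<in> D" and \<delta>: "0 < \<delta>" and k: "0 \<le> k"
    and bdry: "\<And>S y z. finite S \<Longrightarrow> real (card (S - B)) \<le> k \<Longrightarrow> y \<in> D \<Longrightarrow> E y z \<Longrightarrow> z \<notin> D \<Longrightarrow>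
       \<delta> \<le> hit_prob S (B' - B - S) z"
  defines "\<tau> \<equiv> log 2 (1 + \<delta> / 2)"
  defines "\<beta> \<equiv> (1 + \<tau> / 2) / (1 + \<tau>)"
  shows "prob {\<omega> \<in> space M. real (card (idla (\<lambda>i. W x i \<omega>) m - B)) \<le> k \<and>
       \<beta> * k < real (card (idla (\<lambda>i. W x i \<omega>) m - B'))} \<le> 2 powr (- (\<tau> * k / 2))"
proof -
  define a where "a = \<delta> / 2"
  have a: "0 < a" using \<delta> by (simp add: a_def)
  \<comment> \<open>Settling outside \<open>B'\<close> multiplies the weight below by \<open>1 + \<delta> / 2\<close>, settling in the annulus
    halves it. The annulus is at least \<open>\<delta>\<close> times as likely, so the weight is a supermartingale.\<close>
  have \<tau>: "0 < \<tau>" "2 powr \<tau> = 1 + a"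
    unfolding \<tau>_def a_def using \<delta> by auto
  define f :: "'a set \<Rightarrow> real" where "f S = (if real (card (S - B)) \<le> k
      then (1 + a) ^ card (S - B') * (1 / 2) ^ card (S \<inter> B' - B) else 0)" for S
  have f_nonneg: "0 \<le> f S" for S
    unfolding f_def using a by auto
  have step: "f (idla_step S p) \<le> f S * (1 + a * of_bool (hits S (- B' - S) p)
      - 1 / 2 * of_bool (hits S (B' - B - S) p))" if "finite S" for S p
  proof -
    obtain v where v: "idla_step S p = insert v S" by (simp add: idla_step_def)
    have hits: "hits S (- B' - S) p \<longleftrightarrow> v \<in> - B' - S" "hits S (B' - B - S) p \<longleftrightarrow> v \<in> B' - B - S"
      by (rule hits_iff[OF _ v], blast)+
    consider "v \<in> S" | "v \<notin> S" "v \<in> B" | "v \<notin> S" "v \<in> B' - B" | "v \<notin> S" "v \<notin> B'" using sub by blast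
    then show ?thesis
    proof cases
      case 1
      then show ?thesis using v by (simp add: hits insert_absorb)
    next
      case 2
      have "insert v S - B = S - B" "insert v S - B' = S - B'" "insert v S \<inter> B' - B = S \<inter> B' - B"
        using 2 sub by auto
      then show ?thesis using v 2 sub by (auto simp: hits f_def)
    next
      case 3
      have "insert v S - B = insert v (S - B)" "insert v S - B' = S - B'"
        "insert v S \<inter> B' - B = insert v (S \<inter> B' - B)"
        using 3 by auto
      then show ?thesis
        using v 3 that f_nonneg[of S] a by (simp add: hits f_def)
    next
      case 4
      have "insert v S - B = insert v (S - B)" "insert v S - B' = insert v (S - B')"
        "insert v S \<inter> B' - B = S \<inter> B' - B" "v \<notin> B"
        using 4 sub by auto
      then show ?thesis
        using v 4 that f_nonneg[of S] a by (simp add: hits f_def algebra_simps)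
    qed
  qed
  have drift: "a * hit_prob S (- B' - S) x \<le> 1 / 2 * hit_prob S (B' - B - S) x"
    if "finite S" "f S \<noteq> 0" for S
  proof -
    have "real (card (S - B)) \<le> k" using that unfolding f_def by presburger
    then have "\<delta> * hit_prob S (- B' - S) x \<le> hit_prob S (B' - B - S) x"
      using sub x \<delta> bdry[OF that(1)] by (intro hit_prob_compare[of x D]) auto
    then show ?thesis by (simp add: a_def)
  qed
  let ?S = "\<lambda>\<omega>. idla (\<lambda>i. W x i \<omega>) m"
  let ?A = "{\<omega> \<in> space M. real (card (?S \<omega> - B)) \<le> k \<and> \<beta> * k < real (card (?S \<omega> - B'))}"
  \<comment> \<open>On the bad event there are more than \<open>\<beta> * k\<close> factors
    \<open>2 powr \<tau>\<close> against at most \<open>(1 - \<beta>) * k\<close> factors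
    \<open>1 / 2\<close>. The choice of \<open>\<beta>\<close> turns
    \<open>\<tau> * \<beta> * k - (1 - \<beta>) * k\<close> into
    \<open>\<tau> * k / 2\<close>.\<close>
  have lower: "2 powr (\<tau> * k / 2) \<le> f S" if S: "finite S" "real (card (S - B)) \<le> k" "\<beta> * k < real (card (S - B'))" for S
  proof -
    have "S - B = (S - B') \<union> (S \<inter> B' - B)" using sub by auto
    then have "card (S - B) = card (S - B') + card (S \<inter> B' - B)"
      using S(1) by (subst card_Un_disjoint[symmetric]) auto
    then have z: "real (card (S \<inter> B' - B)) \<le> k - \<beta> * k" using S by simp
    have "\<beta> * (1 + \<tau>) = 1 + \<tau> / 2"
      unfolding \<beta>_def using \<tau> by simp
    moreover have "\<tau> * (\<beta> * k) - (k - \<beta> * k) = \<beta> * (1 + \<tau>) * k - k"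
      by (simp add: algebra_simps)
    ultimately have "\<tau> * k / 2 = \<tau> * (\<beta> * k) - (k - \<beta> * k)"
      by (simp add: algebra_simps)
    also have "\<dots> \<le> \<tau> * real (card (S - B')) - real (card (S \<inter> B' - B))"
      using z S(3) \<tau> by (intro diff_mono mult_left_mono) auto
    finally have "2 powr (\<tau> * k / 2) \<le> 2 powr (\<tau> * real (card (S - B')) - real (card (S \<inter> B' - B)))"
      by simp
    also have "\<dots> = (2 powr \<tau>) powr real (card (S - B')) / 2 powr real (card (S \<inter> B' - B))"
      by (simp add: powr_diff powr_powr)
    also have "\<dots> = f S"
      using S \<tau> a by (simp add: f_def powr_realpow power_one_over field_simps)
    finally show ?thesis .
  qed
  have "ennreal (2 powr (\<tau> * k / 2)) * emeasure M ?A = (\<integral>\<^sup>+\<omega>. ennreal (2 powr (\<tau> * k / 2)) * indicator ?A \<omega> \<partial>M)"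
    by (subst nn_integral_cmult_indicator) auto
  also have "\<dots> \<le> (\<integral>\<^sup>+\<omega>. ennreal (f (?S \<omega>)) \<partial>M)"
    by (intro nn_integral_mono) (auto simp: indicator_def finite_idla intro!: ennreal_leI lower)
  also have "\<dots> \<le> ennreal (f {})"
    using a by (intro idla_supermartingale[OF f_nonneg _ _ step drift]) auto
  also have "f {} = 1" using k by (simp add: f_def)
  finally have "2 powr (\<tau> * k / 2) * prob ?A \<le> 1"
    by (simp add: emeasure_eq_measure flip: ennreal_mult)
  then show ?thesis
    by (simp add: powr_minus field_simps)
qed

end

section \<open>Volume growth and iteration over annuli\<close>

lemma is_metric_self: "is_metric \<rho> \<Longrightarrow> \<rho> x x = 0"
  unfolding is_metric_def by blast

lemma cond_VGD:
  assumes "cond_VG \<rho> v0 c d" "x \<in> ball_rho \<rho> v0 n" "n powr (1 / d ^ 3) \<le> r" "r \<le> n" "0 < n"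
  shows "1 / c * r powr d \<le> real (bsize \<rho> x r)" "real (bsize \<rho> x r) \<le> c * r powr d"
  using assms unfolding cond_VG_def by blast+

text \<open>A particle that settles outside the ball arrives there from an occupied point, at
  distance at most \<open>c0\<close>, and raises the count on the right by exactly 1.\<close>

lemma idla_reach:
  assumes metric: "is_metric \<rho>" and R: "0 \<le> R" and c0: "0 \<le> c0"
    and start: "\<And>i. ps i 0 = v0" and step: "\<And>i t. \<rho> (ps i t) (ps i (Suc t)) \<le> c0"
    and v: "v \<in> idla ps m"
  shows "\<rho> v0 v \<le> R + c0 * real (card (idla ps m - ball_rho \<rho> v0 R))"
  using v
proof (induction m arbitrary: v)
  case (Suc m)
  let ?B = "ball_rho \<rho> v0 R" and ?S = "idla ps m" and ?e = "exit_time (idla ps m) (ps m)"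
  have sub: "card (?S - ?B) \<le> card (idla ps (Suc m) - ?B)"
    by (rule card_mono) (auto simp: finite_idla idla_step_def simp del: idla.simps(1))
  then have mono: "R + c0 * real (card (?S - ?B)) \<le> R + c0 * real (card (idla ps (Suc m) - ?B))"
    using c0 by (simp add: mult_left_mono)
  show ?case
  \<comment> \<open>\<open>v = v0\<close> is set apart because a walk that settles at time 0 has no
    previous position.\<close>
  proof (cases "v \<in> ?S \<or> v \<in> ?B \<or> v = v0")
    case True
    have "\<rho> v0 v0 = 0" by (rule is_metric_self[OF metric])
    moreover have "\<rho> v0 v \<le> R" if "v \<in> ?B" using that by (simp add: ball_rho_def)
    moreover have "0 \<le> c0 * real (card (idla ps (Suc m) - ?B))" using c0 by simp
    ultimately show ?thesis using True R Suc.IH[of v] mono by fastforce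
  next
    case False
    then have v: "v = ps m ?e" using Suc.prems by (auto simp: idla_step_def)
    then have "?e \<noteq> 0" using False start[of m] by metis
    then obtain t where t: "?e = Suc t" using not0_implies_Suc by blast
    then have u: "ps m t \<in> ?S" using in_before_exit_time[of t ?S "ps m"] by simp
    have "idla ps (Suc m) - ?B = insert v (?S - ?B)"
      using v False by (auto simp: idla_step_def)
    then have "card (idla ps (Suc m) - ?B) = Suc (card (?S - ?B))"
      using False by (simp add: finite_idla)
    moreover have "\<rho> v0 v \<le> \<rho> v0 (ps m t) + \<rho> (ps m t) v"
      using metric unfolding is_metric_def by blast
    moreover have "\<rho> (ps m t) v \<le> c0" using step[of m t] v t by simp
    ultimately show ?thesis using Suc.IH[OF u] by (simp add: algebra_simps)
  qed
qed simp

text \<open>The parameter \<open>n\<close> of the volume growth condition is an arbitrary positive real; if \<open>d \<le> 1\<close>,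
  the radius \<open>r = n\<close> is admissible for small \<open>n\<close>, where a ball would have less than one point.\<close>

lemma cond_VG_exponent:
  assumes "is_metric \<rho>" "cond_VG \<rho> v0 c d"
  shows "1 < d"
proof (rule ccontr)
  assume "\<not> 1 < d"
  moreover have cd: "0 < c" "0 < d" using assms by (auto simp: cond_VG_def)
  ultimately have d: "0 < d" "d \<le> 1" by auto
  \<comment> \<open>With this radius the upper volume bound is \<open>c / (2 * (c + 1))\<close>,
    which is below 1.\<close>
  define n where "n = (1 / (2 * (c + 1))) powr (1 / d)"
  have n: "0 < n" "n \<le> 1" "n powr d = 1 / (2 * (c + 1))"
    using cd by (auto simp: n_def powr_powr intro!: powr_le1)
  have "1 \<le> 1 / d ^ 3" using d by (simp add: power_le_one)
  then have "n powr (1 / d ^ 3) \<le> n powr 1"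
    using n by (intro powr_mono') auto
  moreover have "v0 \<in> ball_rho \<rho> v0 n"
    using is_metric_self[OF assms(1)] n by (simp add: ball_rho_def)
  ultimately have b: "1 / c * n powr d \<le> real (bsize \<rho> v0 n)" "real (bsize \<rho> v0 n) \<le> c * n powr d"
    using n cond_VGD[OF assms(2), of v0 n n] by auto
  have "0 < 1 / c * n powr d" using cd n by simp
  then have "0 < real (bsize \<rho> v0 n)" using b(1) by linarith
  then have "1 \<le> real (bsize \<rho> v0 n)" by simp
  moreover have "c * n powr d < 1" unfolding n(3) using cd by (simp add: field_simps)
  ultimately show False using b(2) by linarith
qed

lemma cond_VG_center:
  assumes "is_metric \<rho>" "cond_VG \<rho> v0 c d" "1 \<le> n"
  shows "1 / c * n powr d \<le> real (bsize \<rho> v0 n)" "real (bsize \<rho> v0 n) \<le> c * n powr d"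
proof -
  have "1 < d" by (rule cond_VG_exponent[OF assms(1,2)])
  then have "1 / d ^ 3 \<le> 1" by simp
  then have "n powr (1 / d ^ 3) \<le> n powr 1" using assms(3) by (intro powr_mono) auto
  moreover have "v0 \<in> ball_rho \<rho> v0 n"
    using is_metric_self[OF assms(1)] assms(3) by (simp add: ball_rho_def)
  ultimately show "1 / c * n powr d \<le> real (bsize \<rho> v0 n)" "real (bsize \<rho> v0 n) \<le> c * n powr d"
    using assms(3) cond_VGD[OF assms(2), of v0 n n] by auto
qed

text \<open>By connectedness a vertex without neighbours would be the only vertex, while the lower
  volume bound at radius \<open>c + 1\<close> exceeds 1.\<close>

lemma cond_VG_degree_pos:
  fixes E :: "'a \<Rightarrow> 'a \<Rightarrow> bool" and v0 :: 'a
  assumes "is_metric \<rho>" "cond_VG \<rho> v0 c d" "locally_finite_connected_graph E"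
  shows "0 < degree E x"
proof (rule ccontr)
  assume "\<not> 0 < degree E x"
  then have "\<not> E x y" for y
    using assms(3) by (auto simp: degree_def locally_finite_connected_graph_def)
  moreover have "E\<^sup>*\<^sup>* x y" for y using assms(3) by (simp add: locally_finite_connected_graph_def)
  ultimately have "y = x" for y :: 'a using converse_rtranclpE[of E x y] by blast
  then have "ball_rho \<rho> v0 r \<subseteq> {x}" for r by blast
  then have b: "real (bsize \<rho> v0 r) \<le> 1" for r
    unfolding bsize_def using card_mono[of "{x}"] by fastforce
  have c: "0 < c" using assms by (simp add: cond_VG_def)
  have d: "1 < d" by (rule cond_VG_exponent[OF assms(1,2)])
  have "c + 1 \<le> (c + 1) powr d" using powr_mono[of 1 d "c + 1"] c d by simp
  then have "1 < 1 / c * (c + 1) powr d" using c by (simp add: field_simps)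
  then show False using cond_VG_center(1)[OF assms(1,2), of "c + 1"] b[of "c + 1"] c by linarith
qed

section \<open>Absorption near a point, escape through one annulus, and the iteration over
  annuli\<close>

locale idla_bounds = srw_walks E M W
  for E :: "'a \<Rightarrow> 'a \<Rightarrow> bool" and M :: "'w measure" and W :: "'a \<Rightarrow> nat \<Rightarrow> 'w \<Rightarrow> nat \<Rightarrow> 'a" +
  fixes \<rho> :: "'a \<Rightarrow> 'a \<Rightarrow> real" and v0 :: 'a and c d \<alpha> c0 :: real
  assumes metric: "is_metric \<rho>" and VG: "cond_VG \<rho> v0 c d" and \<alpha>_pos: "0 < \<alpha>" and c0_pos: "0 < c0"
    and step: "E x y \<Longrightarrow> \<rho> x y \<le> c0"
    and lower_bound: "\<lbrakk>0 < n; n powr (1 / d ^ 3) \<le> r; r \<le> n; x \<in> ball_rho \<rho> v0 (n + r)\<rbrakk> \<Longrightarrow>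
      \<alpha> \<le> measure M {\<omega> \<in> space M. ball_rho \<rho> x r \<subseteq>
        idla_paused (ball_rho \<rho> x r) (\<lambda>i. W x i \<omega>) (bsize \<rho> x (r / \<alpha>))}"
begin

abbreviation ball :: "real \<Rightarrow> 'a set" where "ball \<equiv> ball_rho \<rho> v0"

abbreviation cluster :: "'w \<Rightarrow> nat \<Rightarrow> 'a set" where "cluster \<omega> \<equiv> idla (\<lambda>i. W v0 i \<omega>)"

lemma triangle: "\<rho> x z \<le> \<rho> x y + \<rho> y z"
  using metric by (simp add: is_metric_def)

lemmas dist_self = is_metric_self[OF metric]

lemma d_gt_1: "1 < d" by (rule cond_VG_exponent[OF metric VG])

lemma c_pos: "0 < c" using VG by (simp add: cond_VG_def)

lemma \<alpha>_le_1: "\<alpha> \<le> 1"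
proof -
  have "v0 \<in> ball_rho \<rho> v0 (1 + 1)" using dist_self by (simp add: ball_rho_def)
  from lower_bound[OF _ _ _ this] show ?thesis
    using prob_le_1 order_trans by fastforce
qed

lemmas VG_bounds = cond_VGD[OF VG]

text \<open>\<open>F\<close> is the empty part of the ball. It has at least
  \<open>r powr d / (2 * c)\<close> points, covering has probability at least
  \<open>\<alpha>\<close>, and at most \<open>c * (r / \<alpha>) powr d\<close> particles are used;
  the quotient is the constant on the left.\<close>

lemma absorption_prob:
  assumes x: "x \<in> ball n" and n: "0 < n" and r: "n powr (1 / d ^ 3) \<le> r" "r / \<alpha> \<le> n"
    and S: "real (card (S \<inter> ball_rho \<rho> x r)) \<le> r powr d / (2 * c)"
  shows "\<alpha> powr (1 + d) / (2 * c\<^sup>2) \<le> hit_prob (ball_rho \<rho> x r \<inter> S) (ball_rho \<rho> x r - S) x"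
proof -
  let ?T = "ball_rho \<rho> x r" and ?h = "hit_prob (ball_rho \<rho> x r \<inter> S) (ball_rho \<rho> x r - S) x"
  have r0: "0 < r" using r(1) n less_le_trans[of 0 "n powr (1 / d ^ 3)" r] by simp
  have ra: "r \<le> r / \<alpha>" using \<alpha>_pos \<alpha>_le_1 r0 by (simp add: field_simps)
  have b: "1 / c * r powr d \<le> real (card ?T)"
    using VG_bounds(1)[OF x r(1)] ra r n by (simp add: bsize_def)
  have m: "real (bsize \<rho> x (r / \<alpha>)) \<le> c * (r / \<alpha>) powr d"
    using VG_bounds(2)[OF x _ r(2) n] ra r by simp
  have pos: "0 < 1 / c * r powr d" using c_pos r0 by simp
  then have "0 < real (card ?T)" using b by linarith
  then have fin: "finite ?T" by (simp add: card_gt_0_iff)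
  have "real (card ?T) = real (card (?T - S)) + real (card (S \<inter> ?T))"
    using card_Int_Diff[OF fin, of S] by (simp add: Int_commute)
  then have F: "r powr d / (2 * c) \<le> real (card (?T - S))" using S b by simp
  have "r powr d / (2 * c) * \<alpha> \<le> real (card (?T - S)) * prob {\<omega> \<in> space M. ?T \<subseteq>
        idla_paused ?T (\<lambda>i. W x i \<omega>) (bsize \<rho> x (r / \<alpha>))}"
  proof (intro mult_mono F lower_bound)
    show "x \<in> ball (n + r)" using x r0 by (simp add: ball_rho_def)
  qed (use r ra n \<alpha>_pos in auto)
  also have "\<dots> \<le> real (bsize \<rho> x (r / \<alpha>)) * ?h"
  proof -
    have "x \<in> ?T" using r0 dist_self by (simp add: ball_rho_def)
    then show ?thesis
      using cover_prob_le_hit_prob[of x ?T "?T - S"] by (simp add: Diff_Diff_Int)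
  qed
  also have "real (bsize \<rho> x (r / \<alpha>)) * ?h \<le> c * (r / \<alpha>) powr d * ?h"
    by (intro mult_right_mono m hit_prob_nonneg)
  finally have "r powr d / (2 * c) * \<alpha> \<le> c * (r / \<alpha>) powr d * ?h" .
  then have le: "r powr d / (2 * c) * \<alpha> \<le> c * (r powr d / \<alpha> powr d) * ?h"
    using \<alpha>_pos r0 by (simp add: powr_divide)
  have "r powr d * (\<alpha> * \<alpha> powr d / (2 * c\<^sup>2)) = r powr d / (2 * c) * \<alpha> * (\<alpha> powr d / c)"
    by (simp add: power2_eq_square)
  also have "\<dots> \<le> c * (r powr d / \<alpha> powr d) * ?h * (\<alpha> powr d / c)"
    using c_pos by (intro mult_right_mono le) simp
  also have "\<dots> = r powr d * ?h" using c_pos \<alpha>_pos by simp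
  finally have "\<alpha> * \<alpha> powr d / (2 * c\<^sup>2) \<le> ?h"
    by (rule mult_left_le_imp_le) (use r0 in simp)
  then show ?thesis using \<alpha>_pos by (simp add: powr_add)
qed

text \<open>\<open>\<tau>\<close> and \<open>\<beta>\<close> are the constants of
  \<open>idla_escape_prob\<close> when \<open>\<delta>\<close> is the bound of
  \<open>absorption_prob\<close>.\<close>

definition \<tau> :: real where "\<tau> = log 2 (1 + \<alpha> powr (1 + d) / (2 * c\<^sup>2) / 2)"

definition \<beta> :: real where "\<beta> = (1 + \<tau> / 2) / (1 + \<tau>)"

text \<open>Ratio of consecutive radii: as \<open>k\<close> is proportional to
  \<open>r powr d\<close>, shrinking \<open>r\<close> by \<open>\<theta>\<close> shrinks
  \<open>k\<close> by \<open>\<beta>\<close>.\<close>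

definition \<theta> :: real where "\<theta> = \<beta> powr (1 / d)"

lemma \<tau>_pos: "0 < \<tau>"
proof -
  have "0 < \<alpha> powr (1 + d) / (2 * c\<^sup>2) / 2" using \<alpha>_pos c_pos by simp
  then have "1 < 1 + \<alpha> powr (1 + d) / (2 * c\<^sup>2) / 2" by linarith
  then show ?thesis unfolding \<tau>_def by (subst zero_less_log_cancel_iff) auto
qed

lemma \<beta>_bounds: "0 < \<beta>" "\<beta> < 1"
  unfolding \<beta>_def using \<tau>_pos by (auto simp: field_simps)

lemma \<theta>_bounds: "0 < \<theta>" "\<theta> < 1" "\<theta> powr d = \<beta>"
  unfolding \<theta>_def using \<beta>_bounds d_gt_1 powr_less_mono2[of "1 / d" \<beta> 1] by (auto simp: powr_powr)

text \<open>With \<open>D = ball (R + r)\<close> and \<open>c0 \<le> r\<close>, a walk leaving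
  \<open>D\<close> lands at a point \<open>z\<close> whose distance from \<open>v0\<close> is at
  least \<open>R + r\<close> and below \<open>R + 2 * r\<close>. The ball of radius \<open>r\<close>
  around \<open>z\<close> thus lies in the annulus, and at most \<open>k\<close> of its points are
  occupied, half of the lower volume bound.\<close>

lemma annulus_escape_prob:
  assumes R: "0 < R" and n: "0 < n" and r: "n powr (1 / d ^ 3) \<le> r" "r / \<alpha> \<le> n" "c0 \<le> r"
    and Rn: "R + 3 * r \<le> n"
  defines "k \<equiv> r powr d / (2 * c)"
  shows "prob {\<omega> \<in> space M. real (card (cluster \<omega> m - ball R)) \<le> k \<and>
      \<beta> * k < real (card (cluster \<omega> m - ball (R + 3 * r)))} \<le> 2 powr (- (\<tau> * k / 2))"
  unfolding \<beta>_def \<tau>_def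
proof (rule idla_escape_prob[of "ball R" "ball (R + 3 * r)" "ball (R + r)"])
  have r0: "0 < r" using c0_pos r by linarith
  show "ball R \<subseteq> ball (R + 3 * r)" "ball (R + r) \<subseteq> ball (R + 3 * r)" "v0 \<in> ball (R + r)"
    using r0 R dist_self by (auto simp: ball_rho_def)
  show "0 < \<alpha> powr (1 + d) / (2 * c\<^sup>2)" using \<alpha>_pos c_pos by simp
  show "0 \<le> k" using c_pos by (simp add: k_def)
  fix S y z
  assume S: "finite S" "real (card (S - ball R)) \<le> k"
    and yz: "y \<in> ball (R + r)" "E y z" "z \<notin> ball (R + r)"
  have z: "R + r \<le> \<rho> v0 z" "\<rho> v0 z < R + 2 * r"
    using yz triangle[of v0 z y] step[OF yz(2)] r by (auto simp: ball_rho_def)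
  have Bz: "ball_rho \<rho> z r \<inter> ball R = {}" "ball_rho \<rho> z r \<subseteq> ball (R + 3 * r)"
  proof -
    show "ball_rho \<rho> z r \<inter> ball R = {}"
    proof (rule ccontr)
      assume "ball_rho \<rho> z r \<inter> ball R \<noteq> {}"
      then obtain u where u: "\<rho> z u < r" "\<rho> v0 u < R" by (auto simp: ball_rho_def)
      have "\<rho> u z = \<rho> z u" using metric by (simp add: is_metric_def)
      then show False using u z triangle[of v0 z u] by linarith
    qed
    show "ball_rho \<rho> z r \<subseteq> ball (R + 3 * r)"
    proof
      fix u assume "u \<in> ball_rho \<rho> z r"
      then show "u \<in> ball (R + 3 * r)"
        using z triangle[of v0 u z] by (simp add: ball_rho_def)
    qed
  qed
  have "card (S \<inter> ball_rho \<rho> z r) \<le> card (S - ball R)"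
    using S Bz by (intro card_mono) auto
  then have "\<alpha> powr (1 + d) / (2 * c\<^sup>2) \<le> hit_prob (ball_rho \<rho> z r \<inter> S) (ball_rho \<rho> z r - S) z"
    using S z Rn r0 by (intro absorption_prob[of z n] n r) (auto simp: k_def ball_rho_def)
  also have "\<dots> \<le> hit_prob S (ball (R + 3 * r) - ball R - S) z"
    using Bz by (intro hit_prob_mono) auto
  finally show "\<alpha> powr (1 + d) / (2 * c\<^sup>2) \<le> hit_prob S (ball (R + 3 * r) - ball R - S) z" .
qed

text \<open>Union bound over the annulus in which the count first fails to drop by the factor
  \<open>\<beta>\<close>. While \<open>r j\<close> is at least \<open>n powr (1 / d ^ 3)\<close>,
  its power \<open>d\<close> is at least \<open>n powr (1 / d\<^sup>2)\<close>, so one error term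
  serves for all \<open>J\<close> annuli.\<close>

lemma iterated_escape_prob:
  fixes r0 R n :: real and J :: nat
  defines "r \<equiv> \<lambda>j. r0 * \<theta> ^ j"
  assumes R: "0 < R" and n: "0 < n" and r0: "0 < r0" "r0 / \<alpha> \<le> n" "R + 3 * r0 / (1 - \<theta>) \<le> n"
    and c0: "c0 \<le> n powr (1 / d ^ 3)"
    and rJ: "\<And>j. j < J \<Longrightarrow> n powr (1 / d ^ 3) \<le> r j"
  shows "prob {\<omega> \<in> space M. real (card (cluster \<omega> m - ball R)) \<le> r 0 powr d / (2 * c) \<and>
      r J powr d / (2 * c) < real (card (cluster \<omega> m - ball (R + 3 * r0 / (1 - \<theta>))))}
    \<le> real J * 2 powr (- (\<tau> * (n powr (1 / d\<^sup>2) / (2 * c)) / 2))"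
proof -
  define k where "k j = r j powr d / (2 * c)" for j
  define Rs where "Rs j = R + 3 * (\<Sum>i<j. r i)" for j
  define p where "p = 2 powr (- (\<tau> * (n powr (1 / d\<^sup>2) / (2 * c)) / 2))"
  have \<theta>: "0 < \<theta>" "\<theta> < 1" using \<theta>_bounds by auto
  have r_pos: "0 < r j" for j using r0 \<theta> by (simp add: r_def)
  have Rs_eq: "Rs j = R + 3 * r0 * (1 - \<theta> ^ j) / (1 - \<theta>)" for j
    using \<theta> by (simp add: Rs_def r_def sum_distrib_left[symmetric] sum_gp_strict)
  have Rs_le: "Rs j \<le> R + 3 * r0 / (1 - \<theta>)" for j
    unfolding Rs_eq using \<theta> r0 by (simp add: divide_right_mono mult_left_le)
  have Rs_ge: "R \<le> Rs j" for j
    unfolding Rs_def using r_pos by (simp add: sum_nonneg less_imp_le)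
  have k_Suc: "k (Suc j) = \<beta> * k j" for j
  proof -
    have "r (Suc j) = r j * \<theta>" by (simp add: r_def)
    then show ?thesis unfolding k_def using r_pos[of j] \<theta> by (simp add: powr_mult \<theta>_bounds(3))
  qed
  have k_ge: "n powr (1 / d\<^sup>2) / (2 * c) \<le> k j" if "j < J" for j
  proof -
    have "n powr (1 / d\<^sup>2) = (n powr (1 / d ^ 3)) powr d"
      using d_gt_1 by (simp add: powr_powr power3_eq_cube power2_eq_square)
    also have "\<dots> \<le> r j powr d" using rJ[OF that] d_gt_1 by (intro powr_mono2) auto
    finally show ?thesis unfolding k_def using c_pos by (simp add: divide_right_mono)
  qed
  let ?E = "\<lambda>j. {\<omega> \<in> space M. real (card (cluster \<omega> m - ball (Rs 0))) \<le> k 0 \<and>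
      k j < real (card (cluster \<omega> m - ball (Rs j)))}"
  have "j \<le> J \<Longrightarrow> prob (?E j) \<le> real j * p" for j
  proof (induction j)
    case 0
    have "?E 0 = {}" by auto
    then show ?case by (metis measure_empty mult_zero_left of_nat_0 order_refl)
  next
    case (Suc j)
    let ?G = "{\<omega> \<in> space M. real (card (cluster \<omega> m - ball (Rs j))) \<le> k j \<and>
      \<beta> * k j < real (card (cluster \<omega> m - ball (Rs j + 3 * r j)))}"
    have RsS: "Rs (Suc j) = Rs j + 3 * r j" by (simp add: Rs_def)
    have "?E (Suc j) \<subseteq> ?E j \<union> ?G" unfolding RsS k_Suc by auto
    then have "prob (?E (Suc j)) \<le> prob (?E j \<union> ?G)"
      by (intro finite_measure_mono) auto
    also have "\<dots> \<le> prob (?E j) + prob ?G"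
      by (intro measure_Un_le) auto
    also have "prob ?G \<le> 2 powr (- (\<tau> * k j / 2))"
      unfolding k_def
    proof (rule annulus_escape_prob[OF _ n])
      show "0 < Rs j" using Rs_ge[of j] R by linarith
      show "n powr (1 / d ^ 3) \<le> r j" using rJ Suc.prems by simp
      then show "c0 \<le> r j" using c0 by linarith
      have "r j \<le> r0" using r0 \<theta> by (simp add: r_def mult_left_le power_le_one)
      then show "r j / \<alpha> \<le> n" using r0(2) \<alpha>_pos by (meson divide_right_mono less_imp_le order_trans)
      show "Rs j + 3 * r j \<le> n" using Rs_le[of "Suc j"] r0(3) unfolding RsS by linarith
    qed
    also have "2 powr (- (\<tau> * k j / 2)) \<le> p"
    proof -
      have "\<tau> * (n powr (1 / d\<^sup>2) / (2 * c)) \<le> \<tau> * k j"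
        using k_ge[of j] Suc.prems \<tau>_pos by (intro mult_left_mono) auto
      then show ?thesis unfolding p_def by simp
    qed
    finally show ?case using Suc by (simp add: algebra_simps)
  qed
  from this[of J] have "prob (?E J) \<le> real J * p" by simp
  moreover have "prob {\<omega> \<in> space M. real (card (cluster \<omega> m - ball R)) \<le> r 0 powr d / (2 * c) \<and>
      r J powr d / (2 * c) < real (card (cluster \<omega> m - ball (R + 3 * r0 / (1 - \<theta>))))} \<le> prob (?E J)"
  proof (rule finite_measure_mono)
    have le: "card (cluster \<omega> m - ball (R + 3 * r0 / (1 - \<theta>))) \<le> card (cluster \<omega> m - ball (Rs J))" for \<omega>
      using Rs_le[of J] by (intro card_mono) (auto simp: finite_idla ball_rho_def)
    have "r J powr d / (2 * c) < real (card (cluster \<omega> m - ball (Rs J)))"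
      if "r J powr d / (2 * c) < real (card (cluster \<omega> m - ball (R + 3 * r0 / (1 - \<theta>))))" for \<omega>
      using that le[of \<omega>] by linarith
    moreover have "Rs 0 = R" by (simp add: Rs_def)
    ultimately show "{\<omega> \<in> space M. real (card (cluster \<omega> m - ball R)) \<le> r 0 powr d / (2 * c) \<and>
      r J powr d / (2 * c) < real (card (cluster \<omega> m - ball (R + 3 * r0 / (1 - \<theta>))))} \<subseteq> ?E J"
      unfolding k_def by auto
  qed auto
  ultimately show ?thesis unfolding p_def by linarith
qed

end

section \<open>Summable error bounds and the Borel-Cantelli argument\<close>

lemma summable_stretched_exponential:
  fixes C a K p :: real
  assumes "0 < C" "0 < a" "0 < K" "0 < p"
  shows "summable (\<lambda>n::nat. (1 + C * real n) * 2 powr (- (a * (K * real n) powr p)))"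
proof (rule summable_comparison_test_bigo)
  show "summable (\<lambda>n::nat. norm (1 / real n ^ 2))"
    using inverse_power_summable[of 2, where 'a=real] by (simp add: inverse_eq_divide)
  show "(\<lambda>n::nat. (1 + C * real n) * 2 powr (- (a * (K * real n) powr p))) \<in> O(\<lambda>n. 1 / real n ^ 2)"
    using assms by real_asymp
qed

lemma eventually_powr_less_linear:
  fixes K p b :: real
  assumes "0 < K" "p < 1" "0 < b"
  shows "eventually (\<lambda>n::nat. (K * real n) powr p < b * real n) sequentially"
proof -
  have "(\<lambda>n::nat. K powr p * real n powr (p - 1)) \<longlonglongrightarrow> K powr p * 0"
    using assms by (intro tendsto_mult tendsto_const tendsto_neg_powr filterlim_real_sequentially) auto
  then have "eventually (\<lambda>n::nat. K powr p * real n powr (p - 1) < b) sequentially"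
    using assms by (intro order_tendstoD(2)[of _ "K powr p * 0"]) auto
  then show ?thesis
    using eventually_gt_at_top[of 0]
  proof eventually_elim
    case (elim n)
    then have "K powr p * real n powr (p - 1) * real n < b * real n" by simp
    moreover have "(K * real n) powr p = K powr p * real n powr (p - 1) * real n"
      using assms(1) elim by (simp add: powr_mult powr_diff)
    ultimately show ?case by simp
  qed
qed

context idla_bounds
begin

text \<open>The factor \<open>1 / \<alpha>\<close> in \<open>N\<close> makes the enlarged radii
  \<open>r / \<alpha>\<close> admissible. By the choice of \<open>r0\<close> all annuli fit into a
  width of \<open>\<epsilon> * n / 2\<close>; the other half is left for the last particles, which
  by \<open>idla_reach\<close> advance at most \<open>c0\<close> each.\<close>

lemma outer_cluster_prob:
  fixes \<epsilon> :: real and n m :: nat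
  defines "N \<equiv> (1 + \<epsilon>) / \<alpha> * real n" and "r0 \<equiv> (1 - \<theta>) / 6 * (\<epsilon> * real n)"
  assumes \<epsilon>: "0 < \<epsilon>" and n: "0 < n" and large: "1 \<le> N powr (1 / d ^ 3)" "c0 \<le> N powr (1 / d ^ 3)"
    "c0 * (N powr (1 / d\<^sup>2) / (2 * c)) < \<epsilon> * real n / 2"
  shows "prob {\<omega> \<in> space M. real (card (cluster \<omega> m - ball (real n))) \<le> r0 powr d / (2 * c) \<and>
      \<not> cluster \<omega> m \<subseteq> ball ((1 + \<epsilon>) * real n)}
    \<le> (1 + r0 / (1 / \<theta> - 1)) * 2 powr (- (\<tau> * (N powr (1 / d\<^sup>2) / (2 * c)) / 2))"
proof -
  have \<theta>: "0 < \<theta>" "\<theta> < 1" using \<theta>_bounds by auto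
  have r0: "0 < r0" using \<theta> \<epsilon> n by (simp add: r0_def)
  have N: "0 < N" using \<epsilon> n \<alpha>_pos by (simp add: N_def)
  have R_end: "real n + 3 * r0 / (1 - \<theta>) = real n + \<epsilon> * real n / 2"
  proof -
    have "3 * r0 = \<epsilon> * real n / 2 * (1 - \<theta>)" by (simp add: r0_def)
    then show ?thesis using \<theta> by simp
  qed
  have "(1 + \<epsilon>) * real n / 1 \<le> (1 + \<epsilon>) * real n / \<alpha>"
    using \<alpha>_pos \<alpha>_le_1 \<epsilon> by (intro divide_left_mono) auto
  then have N_ge: "(1 + \<epsilon>) * real n \<le> N" by (simp add: N_def)
  have "(1 - \<theta>) / 6 * (\<epsilon> * real n) \<le> 1 * ((1 + \<epsilon>) * real n)"
    using \<theta> \<epsilon> by (intro mult_mono) auto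
  then have "r0 / \<alpha> \<le> (1 + \<epsilon>) * real n / \<alpha>"
    using \<alpha>_pos by (intro divide_right_mono) (auto simp: r0_def)
  then have r0_\<alpha>: "r0 / \<alpha> \<le> N" by (simp add: N_def)
  let ?q = "N powr (1 / d ^ 3)"
  define J where "J = (LEAST j. r0 * \<theta> ^ j < ?q)"
  have "\<exists>j. r0 * \<theta> ^ j < ?q"
  proof -
    have "(\<lambda>j. r0 * \<theta> ^ j) \<longlonglongrightarrow> 0"
      using tendsto_mult_right_zero[OF LIMSEQ_realpow_zero[of \<theta>]] \<theta> by simp
    then have "eventually (\<lambda>j. r0 * \<theta> ^ j < ?q) sequentially"
      by (rule order_tendstoD(2)) (use N in simp)
    then show ?thesis by (rule eventually_happens'[OF sequentially_bot])
  qed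
  then have rJ: "r0 * \<theta> ^ J < ?q" unfolding J_def by (rule LeastI_ex)
  have r_ge: "?q \<le> r0 * \<theta> ^ j" if "j < J" for j
    using not_less_Least[OF that[unfolded J_def]] by simp
  \<comment> \<open>\<open>J\<close> is in fact logarithmic in \<open>r0\<close>, but the linear
    bound from Bernoulli's inequality is harmless next to the stretched exponential.\<close>
  have J_le: "real J \<le> 1 + r0 / (1 / \<theta> - 1)"
  proof (cases J)
    case 0
    then show ?thesis using r0 \<theta> by simp
  next
    case (Suc i)
    have "1 \<le> r0 * \<theta> ^ i" using r_ge[of i] large(1) Suc by simp
    then have "1 / \<theta> ^ i \<le> r0" using \<theta> by (simp add: pos_divide_le_eq)
    then have "(1 / \<theta>) ^ i \<le> r0" by (simp add: power_one_over)
    moreover have "1 + real i * (1 / \<theta> - 1) \<le> (1 + (1 / \<theta> - 1)) ^ i"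
      using \<theta> by (intro Bernoulli_inequality) simp
    ultimately have "real i * (1 / \<theta> - 1) \<le> r0" by simp
    moreover have "0 < 1 / \<theta> - 1" using \<theta> by simp
    ultimately have "real i \<le> r0 / (1 / \<theta> - 1)" by (simp add: pos_le_divide_eq)
    then show ?thesis using Suc by simp
  qed
  let ?k = "(r0 * \<theta> ^ J) powr d / (2 * c)"
  let ?E = "{\<omega> \<in> space M. real (card (cluster \<omega> m - ball (real n))) \<le> (r0 * \<theta> ^ 0) powr d / (2 * c) \<and>
      ?k < real (card (cluster \<omega> m - ball (real n + 3 * r0 / (1 - \<theta>))))}"
  have k: "?k \<le> N powr (1 / d\<^sup>2) / (2 * c)"
  proof -
    have "(r0 * \<theta> ^ J) powr d \<le> ?q powr d"
      using rJ r0 \<theta> d_gt_1 by (intro powr_mono2) auto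
    also have "\<dots> = N powr (1 / d\<^sup>2)"
      using d_gt_1 by (simp add: powr_powr power3_eq_cube power2_eq_square)
    finally show ?thesis using c_pos by (simp add: divide_right_mono)
  qed
  have "prob {\<omega> \<in> space M. real (card (cluster \<omega> m - ball (real n))) \<le> r0 powr d / (2 * c) \<and>
      \<not> cluster \<omega> m \<subseteq> ball ((1 + \<epsilon>) * real n)} \<le> prob ?E"
  proof (rule finite_measure_mono_AE)
    show "AE \<omega> in M. \<omega> \<in> {\<omega> \<in> space M. real (card (cluster \<omega> m - ball (real n))) \<le> r0 powr d / (2 * c) \<and>
      \<not> cluster \<omega> m \<subseteq> ball ((1 + \<epsilon>) * real n)} \<longrightarrow> \<omega> \<in> ?E"
      using AE_start[of v0] AE_step[of v0]
    proof eventually_elim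
      case (elim \<omega>)
      have inside: "cluster \<omega> m \<subseteq> ball ((1 + \<epsilon>) * real n)"
        if le: "real (card (cluster \<omega> m - ball (real n + 3 * r0 / (1 - \<theta>)))) \<le> ?k"
      proof
        fix v assume v: "v \<in> cluster \<omega> m"
        have "\<rho> v0 v \<le> (real n + \<epsilon> * real n / 2)
            + c0 * real (card (cluster \<omega> m - ball (real n + \<epsilon> * real n / 2)))"
        proof (rule idla_reach[OF metric _ _ _ _ v])
          show "W v0 i \<omega> 0 = v0" for i using elim by blast
          show "\<rho> (W v0 i \<omega> t) (W v0 i \<omega> (Suc t)) \<le> c0" for i t
            using elim by (intro step) blast
        qed (use \<epsilon> c0_pos in simp_all)
        also have "\<dots> \<le> (real n + \<epsilon> * real n / 2) + c0 * (N powr (1 / d\<^sup>2) / (2 * c))"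
        proof -
          have "real (card (cluster \<omega> m - ball (real n + \<epsilon> * real n / 2))) \<le> N powr (1 / d\<^sup>2) / (2 * c)"
            using le k unfolding R_end by linarith
          then show ?thesis using c0_pos by (simp add: mult_left_mono del: times_divide_eq_right)
        qed
        also have "\<dots> < (1 + \<epsilon>) * real n"
        proof -
          have "(1 + \<epsilon>) * real n = real n + \<epsilon> * real n" by (simp add: algebra_simps)
          then show ?thesis using large(3) by linarith
        qed
        finally show "v \<in> ball ((1 + \<epsilon>) * real n)" by (simp add: ball_rho_def)
      qed
      show ?case
      proof
        assume \<omega>: "\<omega> \<in> {\<omega> \<in> space M. real (card (cluster \<omega> m - ball (real n))) \<le> r0 powr d / (2 * c) \<and>
          \<not> cluster \<omega> m \<subseteq> ball ((1 + \<epsilon>) * real n)}"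
        then have "?k < real (card (cluster \<omega> m - ball (real n + 3 * r0 / (1 - \<theta>))))"
          using inside not_le by blast
        with \<omega> show "\<omega> \<in> ?E" by simp
      qed
    qed
  qed (rule idla_eq_in_sets[where P="\<lambda>S. real (card (S - ball (real n))) \<le> (r0 * \<theta> ^ 0) powr d / (2 * c) \<and>
      ?k < real (card (S - ball (real n + 3 * r0 / (1 - \<theta>))))"])
  also have "\<dots> \<le> real J * 2 powr (- (\<tau> * (N powr (1 / d\<^sup>2) / (2 * c)) / 2))"
  proof (rule iterated_escape_prob[of "real n" N r0 J m])
    have "real n + \<epsilon> * real n / 2 \<le> (1 + \<epsilon>) * real n"
      using \<epsilon> by (simp add: algebra_simps)
    then show "real n + 3 * r0 / (1 - \<theta>) \<le> N" unfolding R_end using N_ge by linarith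
  qed (use n N r0 r0_\<alpha> large(2) r_ge in auto)
  also have "\<dots> \<le> (1 + r0 / (1 / \<theta> - 1)) * 2 powr (- (\<tau> * (N powr (1 / d\<^sup>2) / (2 * c)) / 2))"
    by (intro mult_right_mono J_le) simp
  finally show ?thesis .
qed

text \<open>The unpaused cluster has at most as many points as particles and contains the paused
  one, which lies in the ball. Hence only the deficit of the paused cluster leaves room for points
  outside.\<close>

lemma paused_deficit:
  assumes "\<And>i. W v0 i \<omega> 0 = v0" and n: "0 < n"
    and full: "real (bsize \<rho> v0 (real n)) * (1 - x)
      \<le> real (card (idla_paused (ball (real n)) (\<lambda>i. W v0 i \<omega>) (bsize \<rho> v0 (real n))))"
  shows "real (card (cluster \<omega> (bsize \<rho> v0 (real n)) - ball (real n))) \<le> real (bsize \<rho> v0 (real n)) * x"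
proof -
  let ?b = "bsize \<rho> v0 (real n)" and ?B = "ball (real n)"
  let ?P = "idla_paused ?B (\<lambda>i. W v0 i \<omega>) ?b"
  have "v0 \<in> ?B" using n dist_self by (simp add: ball_rho_def)
  then have "?P \<subseteq> cluster \<omega> ?b \<inter> ?B"
    using assms(1) idla_paused_subset_idla[of ?B "\<lambda>i. W v0 i \<omega>" ?b]
      idla_paused_subset[of ?b "\<lambda>i. W v0 i \<omega>" ?B] by simp
  then have "card ?P \<le> card (cluster \<omega> ?b \<inter> ?B)"
    by (intro card_mono) (simp_all add: finite_idla)
  moreover have "card (cluster \<omega> ?b \<inter> ?B) + card (cluster \<omega> ?b - ?B) \<le> ?b"
    using card_Int_Diff[OF finite_idla, of "\<lambda>i. W v0 i \<omega>" ?b ?B] card_idla_le[of "\<lambda>i. W v0 i \<omega>" ?b] by simp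
  ultimately have "card ?P + card (cluster \<omega> ?b - ?B) \<le> ?b" by linarith
  then have "real (card ?P) + real (card (cluster \<omega> ?b - ?B)) \<le> real ?b" by linarith
  then show ?thesis using full by (simp add: algebra_simps)
qed

text \<open>With this \<open>c1\<close> the annuli, of width three times \<open>(1 - \<theta>) / 6 * \<epsilon> * n * \<theta> ^ j\<close>, have total width
  at most \<open>\<epsilon> * n / 2\<close>.\<close>

definition c1 :: real where "c1 = ((1 - \<theta>) / 6) powr d / (2 * c\<^sup>2)"

text \<open>The events \<open>A n\<close>, where the cluster overflows although few points lie
  outside \<open>ball n\<close>, are summable. Outside \<open>A n\<close> an overflow forces a
  deficit of the paused cluster, by \<open>paused_deficit\<close> read backwards.\<close>

lemma limsup_prob_le:
  assumes \<epsilon>: "0 < \<epsilon>"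
  shows "prob {\<omega> \<in> space M. \<exists>\<^sub>\<infinity>n::nat. \<not> cluster \<omega> (bsize \<rho> v0 (real n)) \<subseteq> ball ((1 + \<epsilon>) * real n)}
    \<le> prob {\<omega> \<in> space M. \<exists>\<^sub>\<infinity>n::nat.
        real (card (idla_paused (ball (real n)) (\<lambda>i. W v0 i \<omega>) (bsize \<rho> v0 (real n))))
          < real (bsize \<rho> v0 (real n)) * (1 - c1 * \<epsilon> powr d)}"
proof -
  let ?b = "\<lambda>n::nat. bsize \<rho> v0 (real n)"
  let ?out = "\<lambda>\<omega> n. \<not> cluster \<omega> (?b n) \<subseteq> ball ((1 + \<epsilon>) * real n)"
  let ?low = "\<lambda>\<omega> n. real (card (idla_paused (ball (real n)) (\<lambda>i. W v0 i \<omega>) (?b n)))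
          < real (?b n) * (1 - c1 * \<epsilon> powr d)"
  define N where "N n = (1 + \<epsilon>) / \<alpha> * real n" for n
  define r0 where "r0 n = (1 - \<theta>) / 6 * (\<epsilon> * real n)" for n
  have \<theta>: "0 < \<theta>" "\<theta> < 1" using \<theta>_bounds by auto
  define K where "K = (1 + \<epsilon>) / \<alpha>"
  have K: "0 < K" using \<epsilon> \<alpha>_pos by (simp add: K_def)
  have d3: "0 < 1 / d ^ 3" and d2: "0 < 1 / d\<^sup>2" "1 / d\<^sup>2 < 1"
    using d_gt_1 one_less_power[of d 2] by simp_all
  define A where "A n = {\<omega> \<in> space M. real (card (cluster \<omega> (?b n) - ball (real n))) \<le> r0 n powr d / (2 * c) \<and>
      ?out \<omega> n}" for n
  have A_sets: "A n \<in> events" for n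
    unfolding A_def by (rule idla_eq_in_sets[where P="\<lambda>S. real (card (S - ball (real n))) \<le> r0 n powr d / (2 * c) \<and>
      \<not> S \<subseteq> ball ((1 + \<epsilon>) * real n)"])
  have "\<And>p. 0 < p \<Longrightarrow> filterlim (\<lambda>n::nat. (K * real n) powr p) at_top sequentially"
    using K by real_asymp
  from this[OF d3, unfolded filterlim_at_top, THEN spec[where x="max 1 c0"]]
  have ev1: "eventually (\<lambda>n::nat. max 1 c0 \<le> (K * real n) powr (1 / d ^ 3)) sequentially" .
  have ev2: "eventually (\<lambda>n::nat. c0 * ((K * real n) powr (1 / d\<^sup>2) / (2 * c)) < \<epsilon> * real n / 2) sequentially"
  proof -
    have "eventually (\<lambda>n::nat. (K * real n) powr (1 / d\<^sup>2) < \<epsilon> * c / c0 * real n) sequentially"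
      using \<epsilon> c_pos c0_pos by (intro eventually_powr_less_linear K d2) simp
    then show ?thesis
    proof eventually_elim
      case (elim n)
      then have "(K * real n) powr (1 / d\<^sup>2) * c0 < \<epsilon> * c / c0 * real n * c0"
        using c0_pos by (rule mult_strict_right_mono)
      then have "(K * real n) powr (1 / d\<^sup>2) * c0 < \<epsilon> * c * real n"
        using c0_pos by simp
      then show ?case using c_pos by (simp add: field_simps)
    qed
  qed
  define C where "C = (1 - \<theta>) / 6 * \<epsilon> / (1 / \<theta> - 1)"
  define a where "a = \<tau> / (4 * c)"
  have "0 < (1 - \<theta>) / 6 * \<epsilon>" "0 < 1 / \<theta> - 1" using \<theta> \<epsilon> by simp_all
  then have C: "0 < C" unfolding C_def by (rule divide_pos_pos)
  have "summable (\<lambda>n::nat. (1 + C * real n) * 2 powr (- (a * (K * real n) powr (1 / d\<^sup>2))))"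
    using \<tau>_pos c_pos by (intro summable_stretched_exponential C K d2) (simp add: a_def)
  moreover have "eventually (\<lambda>n. norm (prob (A n)) \<le> (1 + C * real n) * 2 powr (- (a * (K * real n) powr (1 / d\<^sup>2)))) sequentially"
    using ev1 ev2 eventually_gt_at_top[of 0]
  proof eventually_elim
    case (elim n)
    have "prob (A n) \<le> (1 + r0 n / (1 / \<theta> - 1)) * 2 powr (- (\<tau> * (N n powr (1 / d\<^sup>2) / (2 * c)) / 2))"
      unfolding A_def N_def r0_def
      by (rule outer_cluster_prob[OF \<epsilon>]) (use elim in \<open>simp_all add: K_def\<close>)
    also have "\<dots> = (1 + C * real n) * 2 powr (- (a * (K * real n) powr (1 / d\<^sup>2)))"
    proof -
      have "r0 n / (1 / \<theta> - 1) = C * real n" by (simp add: C_def r0_def)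
      moreover have "\<tau> * (N n powr (1 / d\<^sup>2) / (2 * c)) / 2 = a * (K * real n) powr (1 / d\<^sup>2)"
        by (simp add: a_def N_def K_def)
      ultimately show ?thesis by simp
    qed
    finally show ?case by simp
  qed
  ultimately have "summable (\<lambda>n. prob (A n))"
    by (rule summable_comparison_test_ev[rotated])
  then have "AE \<omega> in M. eventually (\<lambda>n. \<omega> \<in> space M - A n) sequentially"
    by (intro borel_cantelli_AE1 A_sets) (auto simp: emeasure_eq_measure)
  then have AE: "AE \<omega> in M. (\<exists>\<^sub>\<infinity>n. ?out \<omega> n) \<longrightarrow> (\<exists>\<^sub>\<infinity>n. ?low \<omega> n)"
    using AE_start[of v0] AE_space
  proof eventually_elim
    case (elim \<omega>)
    have ev: "eventually (\<lambda>n. ?out \<omega> n \<longrightarrow> ?low \<omega> n) sequentially"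
      using elim(1) eventually_gt_at_top[of 0]
    proof eventually_elim
      case (elim n)
      show ?case
      proof (intro impI, rule ccontr)
        assume out: "?out \<omega> n" and "\<not> ?low \<omega> n"
        then have "real (card (cluster \<omega> (?b n) - ball (real n))) \<le> real (?b n) * (c1 * \<epsilon> powr d)"
          using \<open>\<forall>i. W v0 i \<omega> 0 = v0\<close> elim by (intro paused_deficit) (auto simp: not_less)
        also have "\<dots> \<le> (c * real n powr d) * (c1 * \<epsilon> powr d)"
          using cond_VG_center(2)[OF metric VG, of "real n"] elim \<theta> c_pos
          by (intro mult_right_mono) (auto simp: c1_def)
        \<comment> \<open>\<open>c1\<close> is made for this equality: one factor \<open>c\<close>
          of its denominator cancels the upper volume bound of \<open>ball n\<close>, the remaining
          \<open>2 * c\<close> is that of the first threshold.\<close>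
        also have "\<dots> = r0 n powr d / (2 * c)"
        proof -
          have "r0 n powr d = ((1 - \<theta>) / 6) powr d * (\<epsilon> powr d * real n powr d)"
            unfolding r0_def by (simp only: powr_mult)
          then show ?thesis using c_pos by (simp add: c1_def power2_eq_square)
        qed
        finally have "\<omega> \<in> A n"
          unfolding A_def using out \<open>\<omega> \<in> space M\<close> by blast
        then show False using elim by blast
      qed
    qed
    show ?case
      unfolding cofinite_eq_sequentially
    proof
      assume "frequently (?out \<omega>) sequentially"
      then show "frequently (?low \<omega>) sequentially"
        using ev by (rule frequently_rev_mp)
    qed
  qed
  show ?thesis
  proof (rule finite_measure_mono_AE)
    show "AE \<omega> in M. \<omega> \<in> {\<omega> \<in> space M. \<exists>\<^sub>\<infinity>n. ?out \<omega> n} \<longrightarrow> \<omega> \<in> {\<omega> \<in> space M. \<exists>\<^sub>\<infinity>n. ?low \<omega> n}"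
      using AE
    proof eventually_elim
      case (elim \<omega>)
      then show ?case by (simp only: mem_Collect_eq) iprover
    qed
    have low: "{\<omega> \<in> space M. ?low \<omega> n} \<in> events" for n
      by (rule idla_paused_in_sets[where P="\<lambda>S. real (card S) < real (?b n) * (1 - c1 * \<epsilon> powr d)"])
    show "{\<omega> \<in> space M. \<exists>\<^sub>\<infinity>n. ?low \<omega> n} \<in> events"
      unfolding INFM_nat_le
      by (intro sets.sets_Collect_countable_All sets.sets_Collect_countable_Ex sets.sets_Collect_conj
        sets.sets_Collect_const low)
  qed
qed

end

theorem theorem1p2:
  fixes E :: "'a \<Rightarrow> 'a \<Rightarrow> bool" and \<rho> :: "'a \<Rightarrow> 'a \<Rightarrow> real" and v0 :: 'a
    and M :: "'w measure" and W :: "'a \<Rightarrow> nat \<Rightarrow> 'w \<Rightarrow> nat \<Rightarrow> 'a"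
    and c d :: real
  assumes "locally_finite_connected_graph E"
    and "iid_srw_family E M W"
    and "is_metric \<rho>"
    and "cond_C E \<rho>"
    and "cond_VG \<rho> v0 c d"
    and "cond_wLB \<rho> v0 d M W"
  shows "\<exists>c1>0. \<forall>\<epsilon>>0.
    measure M {\<omega> \<in> space M. \<exists>\<^sub>\<infinity>n::nat.
        \<not> idla (\<lambda>i. W v0 i \<omega>) (bsize \<rho> v0 (real n)) \<subseteq> ball_rho \<rho> v0 ((1 + \<epsilon>) * real n)}
    \<le> measure M {\<omega> \<in> space M. \<exists>\<^sub>\<infinity>n::nat.
        real (card (idla_paused (ball_rho \<rho> v0 (real n)) (\<lambda>i. W v0 i \<omega>) (bsize \<rho> v0 (real n))))
          < real (bsize \<rho> v0 (real n)) * (1 - c1 * \<epsilon> powr d)}"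
proof -
  obtain c0 where c0: "0 < c0" "\<And>x y. \<rho> x y \<le> c0 * real (graph_dist E x y)"
    using assms(4) unfolding cond_C_def by blast
  obtain \<alpha> where \<alpha>: "0 < \<alpha>" "\<And>n r x. \<lbrakk>0 < n; n powr (1 / d ^ 3) \<le> r; r \<le> n; x \<in> ball_rho \<rho> v0 (n + r)\<rbrakk> \<Longrightarrow>
      \<alpha> \<le> measure M {\<omega> \<in> space M. ball_rho \<rho> x r \<subseteq>
        idla_paused (ball_rho \<rho> x r) (\<lambda>i. W x i \<omega>) (bsize \<rho> x (r / \<alpha>))}"
    using assms(6) unfolding cond_wLB_def by blast
  interpret idla_bounds E M W \<rho> v0 c d \<alpha> c0
  proof
    \<comment> \<open>The transition probabilities sum to 1 only at vertices that have a neighbour;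
      this is extracted from the volume growth.\<close>
    show "0 < degree E x" for x by (rule cond_VG_degree_pos[OF assms(3,5,1)])
    show "\<rho> x y \<le> c0" if "E x y" for x y
    proof -
      have "(E ^^ 1) x y" using that by (auto simp: OO_def)
      then have "graph_dist E x y \<le> 1" unfolding graph_dist_def by (rule Least_le)
      then have "c0 * real (graph_dist E x y) \<le> c0 * 1" using c0(1) by (intro mult_left_mono) auto
      then show ?thesis using c0(2)[of x y] by linarith
    qed
  qed (use assms c0 \<alpha> in blast)+
  have "0 < c1" unfolding c1_def using \<theta>_bounds c_pos by simp
  then show ?thesis using limsup_prob_le by blast
qed

end
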